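(* Let $(T,r)$ be a compact $\mathbb{R}$-tree and $\nu$ a Radon measure on $(T,\mathcal{B}(T))$ (finite on compact sets and positive on every open ball). Let $(P_t)_{t\ge0}$ be the semigroup associated with the $\nu$-Brownian motion on $(T,r)$. If $\nu'$ is a probability measure on $(T,\mathcal{B}(T))$ with $\nu'\ll\nu$ such that $\frac{\mathrm{d}\nu'}{\mathrm{d}\nu}\in L^1(\nu')$, then for all $t\ge 0$, $$\Big\|\nu'P_t-\big(\nu(T)\big)^{-1}\nu\Big\|_{\mathrm{TV}}\le\Big(1+\nu(T)\sqrt{\Big(\mathbf{1}_T,\frac{\mathrm{d}\nu'}{\mathrm{d}\nu}\Big)_{\nu'}}\,\Big)\cdot\exp\Big(-\frac{t}{2\,\mathrm{diam}^{(T,r)}(T)\,\nu(T)}\Big),$$ where $\|\cdot\|_{\mathrm{TV}}$ denotes the total variation norm, $\big(\mathbf{1}_T,\frac{\mathrm{d}\nu'}{\mathrm{d}\nu}\big)_{\nu'}=\int_T\frac{\mathrm{d}\nu'}{\mathrm{d}\nu}\,\mathrm{d}\nu'$, and $\mathrm{diam}^{(T,r)}(T)=\sup\{r(x,y):x,y\in T\}$.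
   Context: An $\mathbb{R}$-tree is a metric space $(T,r)$ such that (1) for all $u,v\in T$ there is a unique isometric embedding $\phi_{u,v}:[0,r(u,v)]\to T$ with $\phi_{u,v}(0)=u$, $\phi_{u,v}(r(u,v))=v$; (2) every injective continuous $\kappa:[0,1]\to T$ satisfies $\kappa([0,1])=\phi_{\kappa(0),\kappa(1)}([0,r(\kappa(0),\kappa(1))])$. Write $[a,b]=\phi_{a,b}([0,r(a,b)])$ and $]a,b[=\phi_{a,b}(]0,r(a,b)[)$. For $a,b,x\in T$, $c(a,b,x)$ is the unique point with $[a,x]\cap[a,b]=[a,c(a,b,x)]$. Length measure: locally compact $\mathbb{R}$-trees are separable; $\lambda=\lambda^{(T,r)}$ is the unique $\sigma$-finite Borel measure on $T$ with $\lambda(]a,b[)=r(a,b)$ for all $a,b\in T$ and $\lambda(T\setminus T^o)=0$, where $T^o=\bigcup_{a,b\in T}]a,b[$. Gradient: fix a root $\rho\in T$, put $x\wedge y:=c(\rho,x,y)$ and $\int_x^y\lambda(\mathrm{d}z)\,g(z):=-\int_{[x\wedge y,x]}g\,\mathrm{d}\lambda+\int_{[x\wedge y,y]}g\,\mathrm{d}\lambda$. A continuous $f:T\to\mathbb{R}$ is locally absolutely continuous ($f\in\mathcal{A}$) if for every $\varepsilon>0$ and every $S\subseteq T$ with $\lambda(S)<\infty$ there is $\delta>0$ such that for disjoint arcs $[x_1,y_1],\dots,[x_n,y_n]\subseteq S$ with $\sum_i r(x_i,y_i)<\delta$ one has $\sum_i|f(x_i)-f(y_i)|<\varepsilon$.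 For $f\in\mathcal{A}$, $\nabla f$ is the $\lambda$-a.e. unique function in $L^1_{\mathrm{loc}}(\lambda)$ with $f(y)-f(x)=\int_x^y\lambda(\mathrm{d}z)\,\nabla f(z)$ for all $x,y\in T$. Form: $\mathcal{C}_\infty(T)$ is the set of continuous $f:T\to\mathbb{R}$ such that for every $\varepsilon>0$ there is a compact $K$ with $|f|\le\varepsilon$ on $T\setminus K$ (so all continuous functions when $T$ is compact). $\mathcal{F}:=\{f\in\mathcal{A}:\nabla f\in L^2(\lambda)\}$, $\mathcal{D}(\mathcal{E}):=\mathcal{F}\cap L^2(\nu)\cap\mathcal{C}_\infty(T)$, and $\mathcal{E}(f,g):=\frac12\int\lambda(\mathrm{d}z)\,\nabla f(z)\nabla g(z)$ (independent of the choice of $\rho$). The $\nu$-Brownian motion on $(T,r)$ is the (unique up to $\nu$-equivalence) continuous $\nu$-symmetric strong Markov process $B=((B_t)_{t\ge0},(\mathbf{P}^x)_{x\in T})$ associated with the Dirichlet form $(\mathcal{E},\mathcal{D}(\mathcal{E}))$ on $L^2(\nu)$; $P_tf(x)=\mathbf{E}^x[f(B_t)]$, and $\nu'P_t$ is the law of $B_t$ when $B_0$ has law $\nu'$. *)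

theory Defs
  imports "HOL-Probability.Probability"
begin

text \<open>The tree is the carrier of a type of class \<^class>\<open>metric_space\<close>.\<close>

definition is_geodesic :: "'a::metric_space \<Rightarrow> 'a \<Rightarrow> (real \<Rightarrow> 'a) \<Rightarrow> bool" where
  "is_geodesic u v \<phi> \<longleftrightarrow>
     (\<forall>s\<in>{0..dist u v}. \<forall>t\<in>{0..dist u v}. dist (\<phi> s) (\<phi> t) = dist s t) \<and>
     \<phi> 0 = u \<and> \<phi> (dist u v) = v"

text \<open>Maps on \<open>[0, r(u,v)]\<close> are total functions made unique by \<^const>\<open>extensional\<close>.\<close>

definition geodesic :: "'a::metric_space \<Rightarrow> 'a \<Rightarrow> real \<Rightarrow> 'a" where
  "geodesic u v = (THE \<phi>. \<phi> \<in> extensional {0..dist u v} \<and> is_geodesic u v \<phi>)"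

definition tree_arc :: "'a::metric_space \<Rightarrow> 'a \<Rightarrow> 'a set" where
  "tree_arc a b = geodesic a b ` {0..dist a b}"

definition open_tree_arc :: "'a::metric_space \<Rightarrow> 'a \<Rightarrow> 'a set" where
  "open_tree_arc a b = geodesic a b ` {0<..<dist a b}"

definition R_tree :: "'a::metric_space itself \<Rightarrow> bool" where
  "R_tree _ \<longleftrightarrow>
     (\<forall>u v::'a. \<exists>!\<phi>. \<phi> \<in> extensional {0..dist u v} \<and> is_geodesic u v \<phi>) \<and>
     (\<forall>\<kappa>::real \<Rightarrow> 'a. arc \<kappa> \<longrightarrow> path_image \<kappa> = tree_arc (pathstart \<kappa>) (pathfinish \<kappa>))"

definition branch_point :: "'a::metric_space \<Rightarrow> 'a \<Rightarrow> 'a \<Rightarrow> 'a" where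
  "branch_point a b x = (THE c. tree_arc a x \<inter> tree_arc a b = tree_arc a c)"

definition skeleton :: "'a::metric_space set" where
  "skeleton = (\<Union>a. \<Union>b. open_tree_arc a b)"

definition is_length_measure :: "'a::metric_space measure \<Rightarrow> bool" where
  "is_length_measure L \<longleftrightarrow>
     sets L = sets borel \<and> sigma_finite_measure L \<and>
     (\<forall>a b. emeasure L (open_tree_arc a b) = ennreal (dist a b)) \<and>
     emeasure L (UNIV - skeleton) = 0"

text \<open>On a separable \<open>\<real>\<close>-tree exactly one measure satisfies \<^const>\<open>is_length_measure\<close>.\<close>

definition length_measure :: "'a::metric_space measure" where
  "length_measure = (SOME L. is_length_measure L)"

definition tree_integral :: "'a::metric_space \<Rightarrow> ('a \<Rightarrow> real) \<Rightarrow> 'a \<Rightarrow> 'a \<Rightarrow> real" where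
  "tree_integral \<rho> g x y =
     - (LINT z:tree_arc (branch_point \<rho> x y) x|length_measure. g z)
     + (LINT z:tree_arc (branch_point \<rho> x y) y|length_measure. g z)"

text \<open>The sets \<open>S\<close> are restricted to Borel sets, where the length is defined
  (\<^const>\<open>emeasure\<close> vanishes on non-measurable sets).\<close>

definition loc_abs_continuous :: "('a::metric_space \<Rightarrow> real) set" where
  "loc_abs_continuous = {f. continuous_on UNIV f \<and>
     (\<forall>\<epsilon>>0. \<forall>S\<in>sets borel. emeasure length_measure S < \<infinity> \<longrightarrow>
        (\<exists>\<delta>>0. \<forall>(n::nat) x y.
           disjoint_family_on (\<lambda>i. tree_arc (x i) (y i)) {..<n} \<and>
           (\<forall>i<n. tree_arc (x i) (y i) \<subseteq> S) \<and>
           (\<Sum>i<n. dist (x i) (y i)) < \<delta> \<longrightarrow>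
           (\<Sum>i<n. \<bar>f (x i) - f (y i)\<bar>) < \<epsilon>))}"

text \<open>As in \<^const>\<open>loc_abs_continuous\<close>, ``local'' refers to sets of finite length and not to compact
  sets: a compact tree may have infinite total length.\<close>

definition loc_integrable :: "('a::metric_space \<Rightarrow> real) \<Rightarrow> bool" where
  "loc_integrable g \<longleftrightarrow> g \<in> borel_measurable borel \<and>
     (\<forall>S\<in>sets borel. emeasure length_measure S < \<infinity> \<longrightarrow> set_integrable length_measure S g)"

definition has_gradient :: "'a::metric_space \<Rightarrow> ('a \<Rightarrow> real) \<Rightarrow> ('a \<Rightarrow> real) \<Rightarrow> bool" where
  "has_gradient \<rho> f g \<longleftrightarrow> loc_integrable g \<and> (\<forall>x y. f y - f x = tree_integral \<rho> g x y)"

text \<open>Gradients are unique up to null sets of the length measure; the choice is immaterial below.\<close>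

definition gradient :: "'a::metric_space \<Rightarrow> ('a \<Rightarrow> real) \<Rightarrow> 'a \<Rightarrow> real" where
  "gradient \<rho> f = (SOME g. has_gradient \<rho> f g)"

definition square_integrable :: "'a measure \<Rightarrow> ('a \<Rightarrow> real) \<Rightarrow> bool" where
  "square_integrable M u \<longleftrightarrow> u \<in> borel_measurable M \<and> integrable M (\<lambda>x. (u x)\<^sup>2)"

definition vanishing_at_infinity :: "('a::metric_space \<Rightarrow> real) set" where
  "vanishing_at_infinity = {f. continuous_on UNIV f \<and>
     (\<forall>\<epsilon>>0. \<exists>K. compact K \<and> (\<forall>x\<in>UNIV - K. \<bar>f x\<bar> \<le> \<epsilon>))}"

text \<open>The conjunct \<^const>\<open>has_gradient\<close> says that the term \<open>gradient \<rho> f\<close> denotes a gradient.\<close>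

definition finite_energy :: "'a::metric_space \<Rightarrow> ('a \<Rightarrow> real) set" where
  "finite_energy \<rho> = {f \<in> loc_abs_continuous.
     has_gradient \<rho> f (gradient \<rho> f) \<and> square_integrable length_measure (gradient \<rho> f)}"

definition form_domain :: "'a::metric_space \<Rightarrow> 'a measure \<Rightarrow> ('a \<Rightarrow> real) set" where
  "form_domain \<rho> \<nu> = finite_energy \<rho> \<inter> {f. square_integrable \<nu> f} \<inter> vanishing_at_infinity"

definition energy_form :: "'a::metric_space \<Rightarrow> ('a \<Rightarrow> real) \<Rightarrow> ('a \<Rightarrow> real) \<Rightarrow> real" where
  "energy_form \<rho> f g = (1 / 2) * (\<integral>z. gradient \<rho> f z * gradient \<rho> g z \<partial>length_measure)"

definition transition_operator ::
  "('a \<Rightarrow> 'w measure) \<Rightarrow> (real \<Rightarrow> 'w \<Rightarrow> 'a) \<Rightarrow> real \<Rightarrow> ('a \<Rightarrow> real) \<Rightarrow> 'a \<Rightarrow> real" where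
  "transition_operator P B t f x = (\<integral>\<omega>. f (B t \<omega>) \<partial>P x)"

definition law_at ::
  "('a \<Rightarrow> 'w measure) \<Rightarrow> (real \<Rightarrow> 'w \<Rightarrow> 'a::metric_space) \<Rightarrow> real \<Rightarrow> 'a measure \<Rightarrow> 'a measure" where
  "law_at P B t \<mu> = Giry_Monad.bind \<mu> (\<lambda>x. distr (P x) borel (B t))"

text \<open>The Dirichlet form of a symmetric semigroup \<open>(T\<^sub>t)\<close> on \<open>L\<^sup>2(\<nu>)\<close> is
  \<open>E(f,g) = lim (f - T\<^sub>t f, g) / t\<close> as \<open>t \<down> 0\<close>, with domain the (classes of) functions \<open>u\<close> for which
  \<open>lim (u - T\<^sub>t u, u) / t\<close> is finite. A form on honest functions is given by a set \<open>D\<close> of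
  representatives of the classes in the domain.\<close>

definition approximating_form ::
  "'a measure \<Rightarrow> (real \<Rightarrow> ('a \<Rightarrow> real) \<Rightarrow> 'a \<Rightarrow> real) \<Rightarrow> real \<Rightarrow> ('a \<Rightarrow> real) \<Rightarrow> ('a \<Rightarrow> real) \<Rightarrow> real" where
  "approximating_form \<nu> T t f g = (\<integral>x. (f x - T t f x) * g x \<partial>\<nu>) / t"

definition associated_with_form ::
  "'a measure \<Rightarrow> (real \<Rightarrow> ('a \<Rightarrow> real) \<Rightarrow> 'a \<Rightarrow> real) \<Rightarrow>
   ('a \<Rightarrow> real) set \<Rightarrow> (('a \<Rightarrow> real) \<Rightarrow> ('a \<Rightarrow> real) \<Rightarrow> real) \<Rightarrow> bool" where
  "associated_with_form \<nu> T D E \<longleftrightarrow>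
     (\<forall>u. square_integrable \<nu> u \<longrightarrow>
        (\<exists>l. ((\<lambda>t. approximating_form \<nu> T t u u) \<longlongrightarrow> l) (at_right 0))
        = (\<exists>f\<in>D. AE x in \<nu>. u x = f x)) \<and>
     (\<forall>f\<in>D. \<forall>g\<in>D. ((\<lambda>t. approximating_form \<nu> T t f g) \<longlongrightarrow> E f g) (at_right 0))"

text \<open>Strong Markov processes with continuous paths and infinite lifetime, relative to a
  right-continuous filtration. The index type \<^typ>\<open>ennreal\<close> lets stopping times be infinite; \<open>B t\<close> is
  relevant for \<open>t \<ge> 0\<close> only.\<close>

locale continuous_strong_markov_process = filtration \<Omega> F
  for \<Omega> :: "'w set" and F :: "ennreal \<Rightarrow> 'w measure" +
  fixes P :: "'a::metric_space \<Rightarrow> 'w measure" and B :: "real \<Rightarrow> 'w \<Rightarrow> 'a"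
  assumes filtration_right_continuous:
      "\<And>t. t < \<infinity> \<Longrightarrow> sets (F t) = (\<Inter>s\<in>{t<..}. sets (F s))"
    and prob_space_P: "\<And>x. prob_space (P x)"
    and space_P: "\<And>x. space (P x) = \<Omega>"
    and sets_P: "\<And>x y. sets (P x) = sets (P y)"
    and sets_F: "\<And>t x. sets (F t) \<subseteq> sets (P x)"
    and adapted: "\<And>t. 0 \<le> t \<Longrightarrow> B t \<in> F (ennreal t) \<rightarrow>\<^sub>M borel"
    and kernel: "\<And>t. 0 \<le> t \<Longrightarrow> (\<lambda>x. distr (P x) borel (B t)) \<in> borel \<rightarrow>\<^sub>M prob_algebra borel"
    and start: "\<And>x. AE \<omega> in P x. B 0 \<omega> = x"
    and continuous_paths: "\<And>\<omega>. \<omega> \<in> \<Omega> \<Longrightarrow> continuous_on {0..} (\<lambda>t. B t \<omega>)"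
    and strong_markov:
      "\<And>x \<sigma> s A. stopping_time F \<sigma> \<Longrightarrow> 0 \<le> s \<Longrightarrow> A \<in> sets borel \<Longrightarrow>
         AE \<omega> in P x. \<sigma> \<omega> < \<infinity> \<longrightarrow>
           real_cond_exp (P x) (pre_sigma \<sigma>)
             (indicator {\<omega>'\<in>\<Omega>. \<sigma> \<omega>' < \<infinity> \<and> B (enn2real (\<sigma> \<omega>') + s) \<omega>' \<in> A}) \<omega>
           = measure (P (B (enn2real (\<sigma> \<omega>)) \<omega>)) {\<omega>'\<in>\<Omega>. B s \<omega>' \<in> A}"

locale nu_brownian_motion = continuous_strong_markov_process \<Omega> F P B
  for \<Omega> :: "'w set" and F :: "ennreal \<Rightarrow> 'w measure"
    and P :: "'a::metric_space \<Rightarrow> 'w measure" and B :: "real \<Rightarrow> 'w \<Rightarrow> 'a" +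
  fixes \<rho> :: 'a and \<nu> :: "'a measure"
  assumes symmetric:
      "\<And>t f g. 0 \<le> t \<Longrightarrow> f \<in> borel_measurable borel \<Longrightarrow> g \<in> borel_measurable borel \<Longrightarrow>
         (\<integral>\<^sup>+x. f x * (\<integral>\<^sup>+\<omega>. g (B t \<omega>) \<partial>P x) \<partial>\<nu>) = (\<integral>\<^sup>+x. (\<integral>\<^sup>+\<omega>. f (B t \<omega>) \<partial>P x) * g x \<partial>\<nu>)"
    and associated:
      "associated_with_form \<nu> (transition_operator P B) (form_domain \<rho> \<nu>) (energy_form \<rho>)"

definition radon_full_support :: "'a::metric_space measure \<Rightarrow> bool" where
  "radon_full_support \<nu> \<longleftrightarrow> sets \<nu> = sets borel \<and>
     (\<forall>K. compact K \<longrightarrow> emeasure \<nu> K < \<infinity>) \<and>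
     (\<forall>x. \<forall>e>0. emeasure \<nu> (ball x e) > 0)"

text \<open>The total variation norm of a difference of probability measures, normalised as
  \<open>sup\<^sub>A \<bar>\<mu>(A)\<bar>\<close>, so that mutually singular probability measures are at distance 1.\<close>

definition tv_norm :: "('a::metric_space set \<Rightarrow> real) \<Rightarrow> real" where
  "tv_norm \<mu> = (SUP A\<in>sets borel. \<bar>\<mu> A\<bar>)"

end

theory Submission
  imports Defs
begin

text \<open>
  A function of finite energy satisfies \<open>(f y - f x)\<^sup>2 \<le> 2 D E(f,f)\<close>, where \<open>D\<close> is the diameter. For mean
  zero this gives both a Nash type inequality \<open>\<parallel>f\<parallel>\<^sub>2\<^sup>4 \<le> (\<parallel>f\<parallel>\<^sub>1/2)\<^sup>2 2 D E(f,f)\<close> and a spectral gap. Applied to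
  \<open>f\<^sub>t = P\<^sub>t h - 1/m\<close>, where \<open>h\<close> is a bounded initial density and \<open>m = \<nu>(T)\<close>, the first inequality yields
  \<open>\<parallel>f\<^sub>t\<parallel>\<^sub>2\<^sup>2 \<le> D/t\<close> whatever \<open>h\<close> is, and the second one exponential decay from then on. As
  \<open>f\<^sub>t \<ge> - 1/m\<close>, a total variation distance \<open>V \<ge> 1/2\<close> satisfies \<open>V \<le> w / (1 + w)\<close> with \<open>w = m \<parallel>f\<^sub>t\<parallel>\<^sub>2\<^sup>2\<close>.
  Together these bound \<open>V\<close> by \<open>exp (- t / (2 D m))\<close> for all \<open>t \<ge> 0\<close>, first for bounded \<open>h\<close> and then,
  by truncation, for every density.

  That \<open>P\<^sub>t h\<close> lies in the form domain follows without spectral calculus from the convexity of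
  \<open>t \<mapsto> (h, P\<^sub>t h)\<close>. The constant \<^const>\<open>length_measure\<close> is chosen by \<open>SOME\<close>, so the existence of a length
  measure has to be established as well.
\<close>

section \<open>Arcs in real trees\<close>

lemma is_geodesic_dist:
  assumes "is_geodesic u v \<phi>" "s \<in> {0..dist u v}" "t \<in> {0..dist u v}"
  shows "dist (\<phi> s) (\<phi> t) = \<bar>s - t\<bar>"
  using assms by (auto simp: is_geodesic_def dist_real_def)

locale real_tree =
  fixes T :: "'a::metric_space itself"
  assumes R_tree: "R_tree T"
begin

lemma geodesic_ex1: "\<exists>!\<phi>. \<phi> \<in> extensional {0..dist u v} \<and> is_geodesic u (v::'a) \<phi>"
  using R_tree unfolding R_tree_def by blast

lemma geodesic: "geodesic u v \<in> extensional {0..dist u v}" "is_geodesic u (v::'a) (geodesic u v)"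
  using theI'[OF geodesic_ex1[of u v]] unfolding geodesic_def by auto

text \<open>Uniqueness in \<open>R_tree\<close> holds among \<open>extensional\<close> maps only, so
  a competitor is first restricted to \<open>{0..dist u v}\<close>.\<close>

lemma geodesic_unique:
  assumes "is_geodesic u (v::'a) \<phi>" "s \<in> {0..dist u v}"
  shows "geodesic u v s = \<phi> s"
proof -
  let ?\<psi> = "restrict \<phi> {0..dist u v}"
  have "is_geodesic u v ?\<psi>"
    using assms(1) by (auto simp: is_geodesic_def)
  then have "?\<psi> = geodesic u v"
    using geodesic_ex1[of u v] geodesic[of u v] restrict_extensional[of \<phi>] by blast
  then show ?thesis
    using assms(2) by (metis restrict_apply')
qed

lemma geodesic_dist:
  assumes "0 \<le> s" "s \<le> dist u v" "0 \<le> t" "t \<le> dist u (v::'a)"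
  shows "dist (geodesic u v s) (geodesic u v t) = \<bar>s - t\<bar>"
  using is_geodesic_dist[OF geodesic(2)] assms by auto

lemma geodesic_0 [simp]: "geodesic u (v::'a) 0 = u"
  and geodesic_end [simp]: "geodesic u v (dist u v) = v"
  using geodesic(2)[of u v] by (auto simp: is_geodesic_def)

lemma geodesic_dist_start:
  assumes "0 \<le> s" "s \<le> dist u (v::'a)" shows "dist u (geodesic u v s) = s"
  using geodesic_dist[of 0 u v s] assms by simp

lemma geodesic_dist_end:
  assumes "0 \<le> s" "s \<le> dist u (v::'a)" shows "dist (geodesic u v s) v = dist u v - s"
  using geodesic_dist[of s u v "dist u v"] assms by simp

lemma geodesic_inj: "inj_on (geodesic u (v::'a)) {0..dist u v}"
  by (rule inj_onI) (metis atLeastAtMost_iff geodesic_dist_start)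

lemma continuous_geodesic: "continuous_on {0..dist u v} (geodesic u (v::'a))"
  by (rule continuous_on_iff[THEN iffD2]) (force simp: geodesic_dist dist_real_def)

text \<open>The geodesics from \<open>x\<close> to \<open>z\<close> and from \<open>z\<close> to
  \<open>y\<close> are concatenated to \<open>\<phi>\<close>. It is 1-Lipschitz, and since its
  endpoints are at the full distance \<open>dist x y\<close>, the triangle inequality leaves no room
  for strict contraction. Uniqueness identifies \<open>\<phi>\<close> with
  \<open>geodesic x y\<close>.\<close>

lemma geodesic_through:
  assumes z: "dist x z + dist z y = dist x (y::'a)"
  shows "geodesic x y (dist x z) = z"
proof -
  define \<phi> where "\<phi> s = (if s \<le> dist x z then geodesic x z s else geodesic z y (s - dist x z))" for s
  have le: "dist (\<phi> s) (\<phi> t) \<le> \<bar>s - t\<bar>" if "s \<le> t" "0 \<le> s" "t \<le> dist x y" for s t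
  proof -
    consider "t \<le> dist x z" | "dist x z < s" | "s \<le> dist x z" "dist x z < t" by linarith
    then show ?thesis
    proof cases
      case 3
      have "dist (\<phi> s) (\<phi> t) \<le> dist (geodesic x z s) z + dist z (geodesic z y (t - dist x z))"
        using 3 by (simp add: \<phi>_def dist_triangle)
      also have "\<dots> = t - s"
        using 3 that z by (simp add: geodesic_dist_end geodesic_dist_start)
      finally show ?thesis using that by simp
    qed (use that z in \<open>auto simp: \<phi>_def geodesic_dist\<close>)
  qed
  have ends: "\<phi> 0 = x" "\<phi> (dist x y) = y"
    unfolding \<phi>_def z[symmetric] by (cases "z = y") auto
  have "dist (\<phi> s) (\<phi> t) = \<bar>s - t\<bar>" if "s \<le> t" "0 \<le> s" "t \<le> dist x y" for s t
  proof -
    have "dist x y \<le> dist x (\<phi> s) + dist (\<phi> s) (\<phi> t) + dist (\<phi> t) y"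
      using dist_triangle[of x y "\<phi> s"] dist_triangle[of "\<phi> s" y "\<phi> t"] by linarith
    also have "\<dots> \<le> s + dist (\<phi> s) (\<phi> t) + (dist x y - t)"
      using le[of 0 s] le[of t "dist x y"] that ends by simp
    finally show ?thesis using le[OF that] that by simp
  qed
  then have "is_geodesic x y \<phi>"
    unfolding is_geodesic_def dist_real_def using ends
    by (metis (no_types, opaque_lifting) abs_minus_commute atLeastAtMost_iff dist_commute linear)
  then have "geodesic x y (dist x z) = \<phi> (dist x z)"
    using le_add_same_cancel1[of "dist x z" "dist z y"] unfolding z by (intro geodesic_unique) auto
  then show ?thesis by (simp add: \<phi>_def)
qed

text \<open>This metric characterisation turns most later claims about arcs into linear arithmetic
  with distances.\<close>

lemma mem_tree_arc_iff: "z \<in> tree_arc x y \<longleftrightarrow> dist x z + dist z y = dist x (y::'a)"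
proof
  assume "z \<in> tree_arc x y"
  then show "dist x z + dist z y = dist x y"
    by (auto simp: tree_arc_def geodesic_dist_start geodesic_dist_end)
next
  assume z: "dist x z + dist z y = dist x y"
  then have "dist x z \<in> {0..dist x y}" using le_add_same_cancel1[of "dist x z" "dist z y"] by simp
  then show "z \<in> tree_arc x y"
    using geodesic_through[OF z] unfolding tree_arc_def by (metis image_eqI)
qed

lemma tree_arc_commute: "tree_arc x y = tree_arc y (x::'a)"
  by (auto simp: mem_tree_arc_iff dist_commute add.commute)

lemma ends_in_tree_arc [simp]: "x \<in> tree_arc x (y::'a)" "y \<in> tree_arc x y"
  by (auto simp: mem_tree_arc_iff)

lemma open_tree_arc_eq: "open_tree_arc x y = tree_arc x (y::'a) - {x, y}"
proof -
  have "geodesic x y s \<in> tree_arc x y - {x, y}" if "0 < s" "s < dist x y" for s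
    using that geodesic_dist_start[of s x y] geodesic_dist_end[of s x y]
    by (auto simp: tree_arc_def)
  then have "open_tree_arc x y \<subseteq> tree_arc x y - {x, y}"
    by (auto simp: open_tree_arc_def)
  moreover have "z \<in> open_tree_arc x y" if "z \<in> tree_arc x y - {x, y}" for z
  proof -
    from that obtain s where s: "z = geodesic x y s" "0 \<le> s" "s \<le> dist x y"
      by (auto simp: tree_arc_def)
    with that have "s \<noteq> 0" "s \<noteq> dist x y" by auto
    with s show ?thesis by (auto simp: open_tree_arc_def)
  qed
  ultimately show ?thesis by blast
qed

lemma compact_tree_arc: "compact (tree_arc x (y::'a))"
  unfolding tree_arc_def by (intro compact_continuous_image continuous_geodesic) simp

lemma tree_arc_borel [measurable]: "tree_arc x (y::'a) \<in> sets borel"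
  by (intro borel_closed compact_imp_closed compact_tree_arc)

lemma open_tree_arc_borel [measurable]: "open_tree_arc x (y::'a) \<in> sets borel"
  unfolding open_tree_arc_eq by measurable

lemma tree_arc_geodesic:
  assumes "z \<in> tree_arc x (y::'a)" shows "geodesic x y (dist x z) = z"
  using assms by (simp add: mem_tree_arc_iff geodesic_through)

lemma tree_arc_dist:
  assumes "z \<in> tree_arc x y" "w \<in> tree_arc x (y::'a)"
  shows "dist z w = \<bar>dist x z - dist x w\<bar>"
proof -
  obtain s t where "z = geodesic x y s" "w = geodesic x y t" "s \<in> {0..dist x y}" "t \<in> {0..dist x y}"
    using assms by (auto simp: tree_arc_def)
  then show ?thesis by (simp add: geodesic_dist geodesic_dist_start)
qed

lemma tree_arc_mono:
  assumes "z \<in> tree_arc x (y::'a)" shows "tree_arc x z \<subseteq> tree_arc x y"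
proof
  fix w assume "w \<in> tree_arc x z"
  then have "dist x w + dist w y \<le> dist x y"
    using assms dist_triangle[of w y z] by (simp add: mem_tree_arc_iff)
  then show "w \<in> tree_arc x y" using dist_triangle[of x y w] by (simp add: mem_tree_arc_iff)
qed

lemma tree_arc_initial:
  assumes "w \<in> tree_arc x y" "z \<in> tree_arc x (y::'a)" "dist x w \<le> dist x z"
  shows "w \<in> tree_arc x z"
  using assms(3) tree_arc_dist[OF assms(1,2)] by (simp add: mem_tree_arc_iff)

text \<open>The common part of two arcs issuing from \<open>x\<close> is compact, and
  \<open>c\<close> is its point farthest from \<open>x\<close>. This gives meaning to the
  \<open>THE\<close> in \<open>branch_point\<close>.\<close>

lemma tree_arc_Int_ex1: "\<exists>!c. tree_arc x y \<inter> tree_arc x z = tree_arc x (c::'a)"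
proof (rule ex_ex1I)
  let ?I = "tree_arc x y \<inter> tree_arc x z"
  have "compact ?I" by (intro compact_Int compact_tree_arc)
  moreover have "?I \<noteq> {}" using ends_in_tree_arc(1) by blast
  ultimately obtain c where c: "c \<in> ?I" "\<And>p. p \<in> ?I \<Longrightarrow> dist x p \<le> dist x c"
    using continuous_attains_sup[of ?I "dist x"] continuous_on_dist[OF continuous_on_const continuous_on_id]
    by blast
  then have "?I = tree_arc x c"
    using tree_arc_mono[of c x y] tree_arc_mono[of c x z] tree_arc_initial by blast
  then show "\<exists>c. ?I = tree_arc x c" ..
next
  fix c d assume "tree_arc x y \<inter> tree_arc x z = tree_arc x c" "tree_arc x y \<inter> tree_arc x z = tree_arc x d"
  then have "c \<in> tree_arc x d" "d \<in> tree_arc x c"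
    using ends_in_tree_arc by auto
  then have "dist c d \<le> 0"
    using dist_commute[of c d] unfolding mem_tree_arc_iff by linarith
  then show "c = d" by simp
qed

lemma branch_point: "tree_arc x z \<inter> tree_arc x y = tree_arc x (branch_point x y (z::'a))"
  unfolding branch_point_def using theI'[OF tree_arc_Int_ex1[of x z y]] by simp

lemma branch_point_in:
  shows "branch_point x y (z::'a) \<in> tree_arc x y" "branch_point x y z \<in> tree_arc x z"
proof -
  have "branch_point x y z \<in> tree_arc x z \<inter> tree_arc x y"
    unfolding branch_point by (rule ends_in_tree_arc)
  then show "branch_point x y z \<in> tree_arc x y" "branch_point x y z \<in> tree_arc x z" by auto
qed

lemma arc_geodesic:
  assumes "u \<noteq> (v::'a)"
  shows "arc (\<lambda>s. geodesic u v (dist u v * s))"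
    and "path_image (\<lambda>s. geodesic u v (dist u v * s)) = tree_arc u v"
proof -
  have img: "(\<lambda>s. dist u v * s) ` {0..1} = {0..dist u v}"
    using assms by (simp add: image_mult_atLeastAtMost)
  show "arc (\<lambda>s. geodesic u v (dist u v * s))"
    unfolding arc_def path_def
  proof
    show "continuous_on {0..1} (\<lambda>s. geodesic u v (dist u v * s))"
      by (intro continuous_on_compose2[OF continuous_geodesic] continuous_intros) (use img in auto)
    have "inj_on (\<lambda>s. dist u v * s) {0..1}" using assms by (auto simp: inj_on_def)
    then show "inj_on (\<lambda>s. geodesic u v (dist u v * s)) {0..1}"
      using comp_inj_on[of "\<lambda>s. dist u v * s" "{0..1}" "geodesic u v"] geodesic_inj img
      by (simp add: o_def)
  qed
  show "path_image (\<lambda>s. geodesic u v (dist u v * s)) = tree_arc u v"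
    unfolding path_image_def tree_arc_def img[symmetric] image_image ..
qed

text \<open>The second axiom of \<open>R_tree\<close> enters here. The arc from \<open>y\<close> to
  \<open>c\<close> followed by the arc from \<open>c\<close> to \<open>z\<close> is an injective
  path, because a common point would also lie on \<open>tree_arc x c\<close> and thus be
  \<open>c\<close>. Its image is therefore \<open>tree_arc y z\<close>.\<close>

lemma branch_point_between:
  fixes x y z :: 'a
  defines "c \<equiv> branch_point x y z"
  shows "c \<in> tree_arc y z"
\<comment> \<open>If \<open>c\<close> is an endpoint the claim is trivial; otherwise both
  constant-speed legs are injective.\<close>
proof (cases "c = y \<or> c = z")
  case False
  have c: "c \<in> tree_arc x y" "c \<in> tree_arc x z" and I: "tree_arc x z \<inter> tree_arc x y = tree_arc x c"
    unfolding c_def by (rule branch_point_in branch_point)+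
  have sub: "tree_arc c y \<subseteq> tree_arc x y" "tree_arc c z \<subseteq> tree_arc x z"
    using c tree_arc_mono[of c y x] tree_arc_mono[of c z x] by (simp_all add: tree_arc_commute)
  define g where "g = (\<lambda>s. geodesic y c (dist y c * s))"
  define h where "h = (\<lambda>s. geodesic c z (dist c z * s))"
  have g: "arc g" "path_image g = tree_arc c y" and h: "arc h" "path_image h = tree_arc c z"
    using False arc_geodesic[of y c] arc_geodesic[of c z] tree_arc_commute[of y c]
    unfolding g_def h_def by auto
  have ends: "pathstart g = y" "pathfinish g = c" "pathstart h = c" "pathfinish h = z"
    by (simp_all add: g_def h_def pathstart_def pathfinish_def)
  have "arc (g +++ h)"
  proof (rule arc_join)
    show "path_image g \<inter> path_image h \<subseteq> {pathstart h}"
    proof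
      fix p assume "p \<in> path_image g \<inter> path_image h"
      then have p: "p \<in> tree_arc c y" "p \<in> tree_arc c z"
        using g h by auto
      then have "p \<in> tree_arc x c" using sub I by auto
      then have "dist c p \<le> 0" using p(1) c(1) dist_triangle[of x y p]
        dist_commute[of y c] dist_commute[of y p] dist_commute[of p c]
        unfolding mem_tree_arc_iff by linarith
      then show "p \<in> {pathstart h}" by (simp add: ends)
    qed
  qed (use g h ends in auto)
  then have "path_image (g +++ h) = tree_arc y z"
    using R_tree ends unfolding R_tree_def by auto
  then show ?thesis using g h ends by (auto simp: path_image_join)
qed auto

text \<open>The branch point lies between \<open>a\<close> and \<open>b\<close>, hence within
  \<open>dist a b\<close> of \<open>a\<close>. The point \<open>z\<close> is farther from
  \<open>a\<close>, so it comes before the branch point and is shared by both arcs. This allows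
  endpoints to be replaced by members of a dense sequence.\<close>

lemma tree_arc_stable:
  assumes z: "z \<in> tree_arc x a" and near: "dist a b < dist z (a::'a)"
  shows "z \<in> tree_arc x b"
proof -
  let ?c = "branch_point x a b"
  have c: "?c \<in> tree_arc x a" "?c \<in> tree_arc x b"
    by (rule branch_point_in)+
  have "dist a ?c \<le> dist a b"
    using branch_point_between[of x a b] zero_le_dist[of ?c b] unfolding mem_tree_arc_iff by linarith
  then have "dist x z \<le> dist x ?c"
    using z c near by (simp add: mem_tree_arc_iff dist_commute)
  then show ?thesis using tree_arc_initial[OF z c(1)] tree_arc_mono[OF c(2)] by blast
qed

text \<open>The tripod at \<open>c\<close> expresses any arc by two legs running away from the root
  \<open>x\<close>, the form to which \<open>tree_integral\<close> and the coordinate by distance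
  from the root are adapted.\<close>

lemma tree_arc_split:
  fixes x y z :: 'a
  defines "c \<equiv> branch_point x y z"
  shows "tree_arc y z = tree_arc c y \<union> tree_arc c z" "tree_arc c y \<inter> tree_arc c z = {c}"
    "dist y z = dist c y + dist c z"
proof -
  have c: "c \<in> tree_arc y z" using branch_point_between[of x y z] by (simp add: c_def)
  show d: "dist y z = dist c y + dist c z" using c by (simp add: mem_tree_arc_iff dist_commute)
  have sub: "tree_arc c y \<subseteq> tree_arc y z" "tree_arc c z \<subseteq> tree_arc y z"
    using c tree_arc_mono[of c y z] tree_arc_mono[of c z y] by (simp_all add: tree_arc_commute)
  moreover have "p \<in> tree_arc c y \<union> tree_arc c z" if "p \<in> tree_arc y z" for p
    using that c tree_arc_dist[OF that c] unfolding mem_tree_arc_iff Un_iff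
    by (auto simp: dist_commute)
  ultimately show "tree_arc y z = tree_arc c y \<union> tree_arc c z" by blast
  have "p = c" if "p \<in> tree_arc c y" "p \<in> tree_arc c z" for p
  proof -
    have "dist c p \<le> 0"
      using that d dist_triangle[of y z p] dist_commute[of y p] unfolding mem_tree_arc_iff by linarith
    then show ?thesis by simp
  qed
  then show "tree_arc c y \<inter> tree_arc c z = {c}" by auto
qed

end

section \<open>The length measure\<close>

text \<open>Compactness yields finite nets of radius \<open>1 / Suc n\<close>; their union is
  enumerated.\<close>

lemma compact_dense_sequence:
  assumes "compact (UNIV :: 'a::metric_space set)"
  shows "\<exists>X :: nat \<Rightarrow> 'a::metric_space. \<forall>a. \<forall>e>0. \<exists>n. dist a (X n) < e"
proof -
  have "\<exists>K. finite K \<and> (UNIV::'a set) \<subseteq> (\<Union>x\<in>K. ball x (1 / Suc n))" for n :: nat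
    using seq_compact_imp_totally_bounded[OF compact_imp_seq_compact[OF assms]]
    by (metis of_nat_0_less_iff zero_less_Suc zero_less_divide_1_iff)
  then obtain K where K: "\<And>n. finite (K n)" "\<And>n. (UNIV::'a set) \<subseteq> (\<Union>x\<in>K n. ball x (1 / Suc n))"
    by metis
  have "countable (\<Union>n. K n)" using K(1) by (simp add: countable_finite)
  moreover have "(\<Union>n. K n) \<noteq> {}" using K(2) by fastforce
  ultimately have range: "range (from_nat_into (\<Union>n. K n)) = (\<Union>n. K n)" by (simp add: range_from_nat_into)
  have "\<exists>n. dist a (from_nat_into (\<Union>n. K n) n) < e" if e: "0 < e" for a e
  proof -
    obtain k where k: "1 / Suc k < e" using nat_approx_posE[OF e] by blast
    obtain x where "x \<in> K k" "dist x a < 1 / Suc k" using subsetD[OF K(2)[of k], of a] by auto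
    then show ?thesis using k range
      by (metis (no_types, lifting) UN_I UNIV_I dist_commute image_iff order_less_trans)
  qed
  then show ?thesis by blast
qed

context real_tree
begin

lemma borel_measurable_geodesic [measurable]: "geodesic u (v::'a) \<in> borel_measurable borel"
proof -
  \<comment> \<open>Outside the interval an extensional map is constantly \<open>undefined\<close>,
    so the total function is piecewise continuous.\<close>
  have "geodesic u v = (\<lambda>s. if s \<in> {0..dist u v} then geodesic u v s else undefined)"
    using geodesic(1)[of u v] by (auto simp: extensional_def)
  also have "\<dots> \<in> borel_measurable borel"
    by (intro borel_measurable_continuous_on_if continuous_geodesic continuous_on_const) auto
  finally show ?thesis .
qed

text \<open>\<open>tree_arc_stable\<close> moves first one endpoint and then the other into the
  dense sequence. Countability of the union gives measurability of the skeleton and sigma-finiteness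
  of the length measure.\<close>

lemma skeleton_eq:
  fixes X :: "nat \<Rightarrow> 'a"
  assumes X: "\<And>a e. 0 < e \<Longrightarrow> \<exists>n. dist a (X n) < e"
  shows "skeleton = (\<Union>m n. open_tree_arc (X m) (X n))"
proof
  show "skeleton \<subseteq> (\<Union>m n. open_tree_arc (X m) (X n))"
  proof
    fix p :: 'a assume "p \<in> skeleton"
    then obtain a b where p: "p \<in> tree_arc a b" "p \<noteq> a" "p \<noteq> b"
      by (auto simp: skeleton_def open_tree_arc_eq)
    obtain n where n: "dist b (X n) < dist p b" using X[of "dist p b" b] p by auto
    then have pn: "p \<in> tree_arc (X n) a"
      using tree_arc_stable[OF p(1)] tree_arc_commute by blast
    obtain m where m: "dist a (X m) < dist p a" using X[of "dist p a" a] p by auto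
    then have "p \<in> tree_arc (X m) (X n)"
      using tree_arc_stable[OF pn] tree_arc_commute by blast
    moreover have "p \<noteq> X m" "p \<noteq> X n" using m n by (auto simp: dist_commute)
    ultimately show "p \<in> (\<Union>m n. open_tree_arc (X m) (X n))" by (auto simp: open_tree_arc_eq)
  qed
qed (auto simp: skeleton_def)

lemma skeleton_borel:
  assumes "compact (UNIV :: 'a set)"
  shows "(skeleton :: 'a set) \<in> sets borel"
proof -
  obtain X :: "nat \<Rightarrow> 'a" where "\<And>a e. 0 < e \<Longrightarrow> \<exists>n. dist a (X n) < e"
    using compact_dense_sequence[OF assms] by metis
  then have "skeleton = (\<Union>m n. open_tree_arc (X m) (X n))" by (rule skeleton_eq)
  moreover have "(\<Union>m n. open_tree_arc (X m) (X n)) \<in> sets borel" by measurable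
  ultimately show ?thesis by metis
qed

text \<open>Along an arc \<open>[\<rho>,a]\<close> the distance from the root is an isometric coordinate, so the new part
  \<open>[\<rho>,X n] - (\<Union>k<n. [\<rho>,X k])\<close> of each arc in a dense sequence carries a copy of Lebesgue measure.\<close>

lemma length_measure_exists:
  assumes "compact (UNIV :: 'a set)"
  shows "\<exists>L :: 'a measure. is_length_measure L"
proof -
  obtain X :: "nat \<Rightarrow> 'a" where X: "\<And>a e. 0 < e \<Longrightarrow> \<exists>n. dist a (X n) < e"
    using compact_dense_sequence[OF assms] by metis
  define \<rho> where "\<rho> = X 0"
  \<comment> \<open>\<open>A n\<close> holds the coordinates of the points that arc number
    \<open>n\<close> adds to the earlier arcs; the root, with coordinate 0, is left out.\<close>
  define A where "A n = {s \<in> {0<..dist \<rho> (X n)}. geodesic \<rho> (X n) s \<notin> (\<Union>k<n. tree_arc \<rho> (X k))}" for n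
  have A [measurable]: "A n \<in> sets borel" for n
  proof -
    define N where "N = (\<Union>k<n. tree_arc \<rho> (X k))"
    have [measurable]: "N \<in> sets borel" unfolding N_def by (intro sets.finite_UN) auto
    show ?thesis unfolding A_def N_def[symmetric] by measurable
  qed
  define M where "M n = distr (density lborel (indicator (A n))) borel (geodesic \<rho> (X n))" for n
  have sets_M: "sets (M n) = sets borel" for n by (simp add: M_def)
  have M: "emeasure (M n) S = emeasure lborel {s \<in> A n. geodesic \<rho> (X n) s \<in> S}"
    if [measurable]: "S \<in> sets borel" for n S
  proof -
    have "emeasure (M n) S = emeasure (density lborel (indicator (A n))) (geodesic \<rho> (X n) -` S)"
      by (simp add: M_def emeasure_distr)
    also have "\<dots> = (\<integral>\<^sup>+ s. indicator (A n) s * indicator (geodesic \<rho> (X n) -` S) s \<partial>lborel)"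
      by (subst emeasure_density) (auto intro: measurable_sets_borel[OF borel_measurable_geodesic])
    also have "\<dots> = (\<integral>\<^sup>+ s. indicator {s \<in> A n. geodesic \<rho> (X n) s \<in> S} s \<partial>lborel)"
      by (intro nn_integral_cong) (auto simp: indicator_def)
    finally show ?thesis by simp
  qed
  define L where "L = measure_of (UNIV :: 'a set) (sets borel) (\<lambda>S. \<Sum>n. emeasure (M n) S)"
  have sets_L: "sets L = sets borel"
    unfolding L_def using sets.sigma_sets_eq[of "borel :: 'a measure"] by simp
  have space_L: "space L = UNIV" by (simp add: L_def)
  have L0: "emeasure L S = (\<Sum>n. emeasure (M n) S)" if "S \<in> sets borel" for S
  proof (rule emeasure_measure_of[OF L_def])
    show "countably_additive (sets L) (\<lambda>S. \<Sum>n. emeasure (M n) S)"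
      unfolding countably_additive_def sets_L
    proof (intro allI impI)
      fix S :: "nat \<Rightarrow> 'a set" assume S: "range S \<subseteq> sets borel" "disjoint_family S" "\<Union> (range S) \<in> sets borel"
      \<comment> \<open>The two infinite sums are interchanged by reading the outer one as an
        integral over counting measure.\<close>
      have "(\<Sum>i. \<Sum>n. emeasure (M n) (S i)) = (\<integral>\<^sup>+ i. (\<Sum>n. emeasure (M n) (S i)) \<partial>count_space UNIV)"
        by (simp add: nn_integral_count_space_nat)
      also have "\<dots> = (\<Sum>n. \<Sum>i. emeasure (M n) (S i))"
        by (subst nn_integral_suminf) (simp_all add: nn_integral_count_space_nat)
      also have "\<dots> = (\<Sum>n. emeasure (M n) (\<Union> (range S)))"
        using S by (subst suminf_emeasure) (auto simp: sets_M)
      finally show "(\<Sum>i. \<Sum>n. emeasure (M n) (S i)) = (\<Sum>n. emeasure (M n) (\<Union> (range S)))" .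
    qed
  qed (use that sets_L in \<open>auto simp: positive_def\<close>)
  have L: "emeasure L S = (\<Sum>n. emeasure lborel {s \<in> A n. geodesic \<rho> (X n) s \<in> S})"
    if "S \<in> sets borel" for S
    using that by (simp add: L0 M)
  \<comment> \<open>A set that meets every new piece in at most one coordinate is null. This serves
    for single points and for the complement of the skeleton.\<close>
  have null: "emeasure L S = 0" if "S \<in> sets borel" "\<And>n. \<exists>s. {s \<in> A n. geodesic \<rho> (X n) s \<in> S} \<subseteq> {s}" for S
  proof -
    have "emeasure lborel {s \<in> A n. geodesic \<rho> (X n) s \<in> S} = 0" for n
      using that(2)[of n] by (metis emeasure_lborel_countable countable_empty countable_insert countable_subset)
    then show ?thesis using that(1) by (simp add: L)
  qed
  have point: "{p} \<in> null_sets L" for p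
  proof (rule null_setsI)
    show "emeasure L {p} = 0"
    proof (rule null)
      fix n show "\<exists>s. {s \<in> A n. geodesic \<rho> (X n) s \<in> {p}} \<subseteq> {s}"
        by (rule exI[of _ "dist \<rho> p"]) (auto simp: A_def geodesic_dist_start)
    qed simp
  qed (simp add: sets_L)
  \<comment> \<open>For an arc pointing away from the root, the coordinate sets \<open>J n\<close>
    partition the interval between \<open>dist \<rho> c\<close> and \<open>dist \<rho> a\<close>, so
    Lebesgue measure gives its length.\<close>
  have vertical: "emeasure L (open_tree_arc c a) = ennreal (dist c a)" if c: "c \<in> tree_arc \<rho> a" for a c
  proof -
    define J where "J n = {s \<in> A n. geodesic \<rho> (X n) s \<in> open_tree_arc c a}" for n
    have sub: "tree_arc c a \<subseteq> tree_arc \<rho> a"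
      using tree_arc_mono[of c a \<rho>] c by (simp add: tree_arc_commute)
    have JD: "s \<in> {dist \<rho> c<..<dist \<rho> a}" "geodesic \<rho> (X n) s = geodesic \<rho> a s" if "s \<in> J n" for s n
    proof -
      let ?z = "geodesic \<rho> (X n) s"
      have s: "dist \<rho> ?z = s" using that by (auto simp: J_def A_def geodesic_dist_start)
      have z: "?z \<in> tree_arc c a" "?z \<noteq> c" "?z \<noteq> a" using that by (auto simp: J_def open_tree_arc_eq)
      then have za: "?z \<in> tree_arc \<rho> a" using sub by blast
      show "geodesic \<rho> (X n) s = geodesic \<rho> a s"
        using tree_arc_geodesic[OF za] s by simp
      have "0 < dist c ?z" "0 < dist ?z a" using z by auto
      moreover have "dist c ?z + dist ?z a = dist c a" "dist \<rho> ?z + dist ?z a = dist \<rho> a"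
        "dist \<rho> c + dist c a = dist \<rho> a"
        using z za c by (simp_all add: mem_tree_arc_iff)
      ultimately show "s \<in> {dist \<rho> c<..<dist \<rho> a}"
        using s unfolding greaterThanLessThan_iff by linarith
    qed
    have disj: "disjoint_family J"
      unfolding disjoint_family_on_def
    proof (intro ballI impI)
      have False if "n < k" "s \<in> J n" "s \<in> J k" for n k s
      proof -
        have "geodesic \<rho> (X k) s = geodesic \<rho> (X n) s" using JD that by simp
        moreover have "geodesic \<rho> (X n) s \<in> tree_arc \<rho> (X n)"
          using that(2) by (auto simp: J_def A_def tree_arc_def)
        ultimately show False using that(1,3) by (auto simp: J_def A_def)
      qed
      then show "J n \<inter> J k = {}" if "n \<noteq> k" for n k using that by (metis disjoint_iff nat_neq_iff)
    qed
    have union: "(\<Union>n. J n) = {dist \<rho> c<..<dist \<rho> a}"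
    proof
      show "{dist \<rho> c<..<dist \<rho> a} \<subseteq> (\<Union>n. J n)"
      proof
        fix s assume s: "s \<in> {dist \<rho> c<..<dist \<rho> a}"
        then have s0: "0 < s" using zero_le_dist[of \<rho> c] unfolding greaterThanLessThan_iff by linarith
        define z where "z = geodesic \<rho> a s"
        have dz: "dist \<rho> z = s" and zr: "z \<in> tree_arc \<rho> a"
          using s s0 by (auto simp: z_def geodesic_dist_start tree_arc_def)
        have "0 < dist z a" using dz s by auto
        then obtain n where "dist a (X n) < dist z a" using X by blast
        then have "z \<in> tree_arc \<rho> (X n)" using tree_arc_stable[OF zr] by blast
        \<comment> \<open>The first index whose arc contains \<open>z\<close> is the one whose new
          piece contains it.\<close>
        then have n: "z \<in> tree_arc \<rho> (X (LEAST n. z \<in> tree_arc \<rho> (X n)))" by (rule LeastI)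
        define m where "m = (LEAST n. z \<in> tree_arc \<rho> (X n))"
        have m: "z \<in> tree_arc \<rho> (X m)" and notk: "\<And>k. k < m \<Longrightarrow> z \<notin> tree_arc \<rho> (X k)"
          using n not_less_Least by (auto simp: m_def)
        have gz: "geodesic \<rho> (X m) s = z" using tree_arc_geodesic[OF m] dz by simp
        have sm: "s \<le> dist \<rho> (X m)" using m dz zero_le_dist[of z "X m"] unfolding mem_tree_arc_iff by linarith
        have "c \<noteq> z" "z \<noteq> a" using s dz by auto
        moreover have "z \<in> tree_arc a c"
          using tree_arc_dist[OF c zr] zr c s dz dist_commute[of z c] dist_commute[of z a] dist_commute[of a c]
          unfolding mem_tree_arc_iff greaterThanLessThan_iff by linarith
        ultimately have "s \<in> J m"
          using s0 sm gz notk by (auto simp: J_def A_def open_tree_arc_eq tree_arc_commute)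
        then show "s \<in> (\<Union>n. J n)" by blast
      qed
    qed (use JD in blast)
    have [measurable]: "J n \<in> sets borel" for n unfolding J_def by measurable
    have "emeasure L (open_tree_arc c a) = (\<Sum>n. emeasure lborel (J n))"
      by (simp add: L J_def)
    also have "\<dots> = emeasure lborel {dist \<rho> c<..<dist \<rho> a}"
      using disj by (subst suminf_emeasure) (auto simp: union)
    also have "\<dots> = ennreal (dist \<rho> a - dist \<rho> c)"
      using c zero_le_dist[of c a] unfolding mem_tree_arc_iff by (intro emeasure_lborel_Ioo) linarith
    also have "dist \<rho> a - dist \<rho> c = dist c a"
      using c unfolding mem_tree_arc_iff by linarith
    finally show ?thesis .
  qed
  \<comment> \<open>A general arc is split at its branch point into two arcs of the previous kind;
    the points \<open>a\<close>, \<open>b\<close>, \<open>c\<close> carry no mass.\<close>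
  have arcs: "emeasure L (open_tree_arc a b) = ennreal (dist a b)" for a b
  proof -
    define c where "c = branch_point \<rho> a b"
    note split = tree_arc_split[where x = \<rho> and y = a and z = b, folded c_def]
    have vert: "c \<in> tree_arc \<rho> a" "c \<in> tree_arc \<rho> b" using branch_point_in by (auto simp: c_def)
    have N: "{a, b, c} \<in> null_sets L"
      using null_sets.Un[OF point[of a] null_sets.Un[OF point[of b] point[of c]]] by (simp add: insert_commute)
    have disj: "open_tree_arc c a \<inter> open_tree_arc c b = {}" using split(2) by (auto simp: open_tree_arc_eq)
    have "emeasure L (open_tree_arc a b) = emeasure L (open_tree_arc a b \<union> {a, b, c})"
      using N by (intro emeasure_Un_null_set[symmetric]) (simp_all add: sets_L)
    also have "open_tree_arc a b \<union> {a, b, c} = (open_tree_arc c a \<union> open_tree_arc c b) \<union> {a, b, c}"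
      using split(1) by (auto simp: open_tree_arc_eq)
    also have "emeasure L \<dots> = emeasure L (open_tree_arc c a \<union> open_tree_arc c b)"
      using N by (intro emeasure_Un_null_set) (simp_all add: sets_L)
    also have "\<dots> = emeasure L (open_tree_arc c a) + emeasure L (open_tree_arc c b)"
      using disj by (intro plus_emeasure[symmetric]) (simp_all add: sets_L)
    also have "\<dots> = ennreal (dist a b)"
      using split(3) vert by (simp add: vertical)
    finally show ?thesis .
  qed
  have skel: "emeasure L (UNIV - skeleton) = 0"
  proof (rule null)
    fix n
    \<comment> \<open>Within the new piece of arc number \<open>n\<close>, only its endpoint
      \<open>X n\<close> can miss the skeleton.\<close>
    have "geodesic \<rho> (X n) s \<in> skeleton" if "s \<in> A n" "s \<noteq> dist \<rho> (X n)" for s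
      using that by (force simp: A_def skeleton_def open_tree_arc_def)
    then show "\<exists>s. {s \<in> A n. geodesic \<rho> (X n) s \<in> UNIV - skeleton} \<subseteq> {s}" by blast
  qed (use skeleton_borel[OF assms] in auto)
  have "sigma_finite_measure L"
  proof
    let ?R = "UNIV - skeleton :: 'a set" and ?C = "range (\<lambda>(m, n). open_tree_arc (X m) (X n))"
    have "\<Union> (insert ?R ?C) = space L" using skeleton_eq[OF X] by (auto simp: space_L)
    moreover have "\<forall>S\<in>insert ?R ?C. emeasure L S \<noteq> \<infinity>" using skel arcs by auto
    moreover have "countable (insert ?R ?C)" by simp
    moreover have "insert ?R ?C \<subseteq> sets L" using skeleton_borel[OF assms] by (auto simp: sets_L)
    ultimately show "\<exists>A. countable A \<and> A \<subseteq> sets L \<and> \<Union> A = space L \<and> (\<forall>a\<in>A. emeasure L a \<noteq> \<infinity>)"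
      by blast
  qed
  with sets_L arcs skel have "is_length_measure L" by (simp add: is_length_measure_def)
  then show ?thesis ..
qed

lemma length_measure:
  assumes "compact (UNIV :: 'a set)"
  shows "is_length_measure (length_measure :: 'a measure)"
  unfolding length_measure_def by (rule someI_ex[OF length_measure_exists[OF assms]])

text \<open>If \<open>p\<close> lies strictly between \<open>a\<close> and \<open>b\<close>, the
  open arcs from \<open>a\<close> to \<open>p\<close> and from \<open>p\<close> to \<open>b\<close>
  already exhaust the finite length of the open arc from \<open>a\<close> to \<open>b\<close>.
  Points off the skeleton lie in a null set. Only the defining properties of \<open>L\<close> are
  used, as nothing else is known about the chosen \<open>length_measure\<close>.\<close>

lemma length_measure_point:
  assumes "compact (UNIV :: 'a set)" and L: "is_length_measure (L :: 'a measure)"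
  shows "{p} \<in> null_sets L"
proof (rule null_setsI)
  have sets_L: "sets L = sets borel" and arcs: "\<And>a b. emeasure L (open_tree_arc a b) = ennreal (dist a b)"
    and skel: "emeasure L (UNIV - skeleton) = 0"
    using L by (auto simp: is_length_measure_def)
  show "{p} \<in> sets L" by (simp add: sets_L)
  show "emeasure L {p} = 0"
  proof (cases "p \<in> skeleton")
    case True
    then obtain a b where p: "p \<in> tree_arc a b" "p \<noteq> a" "p \<noteq> b"
      by (auto simp: skeleton_def open_tree_arc_eq)
    have sub: "tree_arc a p \<subseteq> tree_arc a b" "tree_arc p b \<subseteq> tree_arc a b"
      using p(1) tree_arc_mono[of p a b] tree_arc_mono[of p b a] by (simp_all add: tree_arc_commute)
    have eq: "dist a p + dist p b = dist a b" using p(1) by (simp add: mem_tree_arc_iff)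
    have "q = p" if "q \<in> tree_arc a p" "q \<in> tree_arc p b" for q
    proof -
      have "dist q p \<le> 0" using that eq dist_triangle[of a b q] dist_commute[of p q]
        unfolding mem_tree_arc_iff by linarith
      then show ?thesis by simp
    qed
    then have disj: "open_tree_arc a p \<inter> open_tree_arc p b = {}" by (auto simp: open_tree_arc_eq)
    have b: "b \<notin> open_tree_arc a p" "a \<notin> open_tree_arc p b"
      using p(2,3) eq zero_less_dist_iff[of p b] zero_less_dist_iff[of a p] dist_commute[of b p] dist_commute[of p a]
      unfolding open_tree_arc_eq Diff_iff mem_tree_arc_iff by (smt (verit))+
    have "ennreal (dist a p) + ennreal (dist p b) + emeasure L {p}
        = emeasure L (open_tree_arc a p \<union> open_tree_arc p b \<union> {p})"
      using disj arcs
      by (subst plus_emeasure[symmetric], simp_all add: sets_L open_tree_arc_eq)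
        (subst plus_emeasure[symmetric], simp_all add: sets_L arcs flip: open_tree_arc_eq)
    also have "\<dots> \<le> emeasure L (open_tree_arc a b)"
      using sub p b by (intro emeasure_mono) (auto simp: open_tree_arc_eq sets_L)
    also have "\<dots> = ennreal (dist a p) + ennreal (dist p b)"
      using eq by (simp add: arcs flip: ennreal_plus)
    finally show ?thesis
      by (metis add.right_neutral ennreal_add_left_cancel_le ennreal_neq_top ennreal_plus eq le_zero_eq zero_le_dist infinity_ennreal_def)
  next
    case False
    have "emeasure L {p} \<le> emeasure L (UNIV - skeleton)"
      using False skeleton_borel[OF assms(1)] by (intro emeasure_mono) (auto simp: sets_L)
    then show ?thesis using skel by simp
  qed
qed

lemma length_measure_tree_arc:
  assumes "compact (UNIV :: 'a set)"
  shows "emeasure length_measure (tree_arc x (y::'a)) = ennreal (dist x y)"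
proof -
  note L = length_measure[OF assms]
  have sets_L: "sets (length_measure :: 'a measure) = sets borel" using L by (simp add: is_length_measure_def)
  have "{x, y} \<in> null_sets length_measure"
    using null_sets.Un[OF length_measure_point[OF assms L, of x] length_measure_point[OF assms L, of y]]
    by (simp add: insert_commute)
  then have "emeasure length_measure (open_tree_arc x y \<union> {x, y}) = emeasure length_measure (open_tree_arc x y)"
    by (intro emeasure_Un_null_set) (simp_all add: sets_L)
  moreover have "open_tree_arc x y \<union> {x, y} = tree_arc x y" by (auto simp: open_tree_arc_eq)
  ultimately show ?thesis using L by (simp add: is_length_measure_def)
qed

end

section \<open>Oscillation and energy\<close>

text \<open>Cauchy-Schwarz against the constant 1, obtained by integrating the square of
  \<open>u - a\<close>, where \<open>a\<close> is the mean of \<open>u\<close> over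
  \<open>S\<close>.\<close>

lemma set_integral_power2_le:
  fixes u :: "'b \<Rightarrow> real"
  assumes S: "S \<in> sets M" "emeasure M S < \<infinity>"
    and u: "set_integrable M S u" "set_integrable M S (\<lambda>x. (u x)\<^sup>2)"
  shows "(LINT x:S|M. u x)\<^sup>2 \<le> measure M S * (LINT x:S|M. (u x)\<^sup>2)"
proof (cases "measure M S = 0")
  case True
  then have "S \<in> null_sets M" using S by (auto simp: measure_def enn2real_eq_0_iff)
  then have "AE x in M. indicator S x *\<^sub>R u x = 0"
    by (intro AE_I'[of S]) (auto simp: indicator_def)
  then have "(LINT x:S|M. u x) = 0"
    unfolding set_lebesgue_integral_def by (rule integral_eq_zero_AE)
  then show ?thesis using True by simp
next
  case False
  define a where "a = (LINT x:S|M. u x) / measure M S"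
  have const: "set_integrable M S (\<lambda>_. a\<^sup>2)"
    using S by (simp add: set_integrable_def)
  have "0 \<le> (LINT x:S|M. (u x)\<^sup>2 - 2 * a * u x + a\<^sup>2)"
    unfolding set_lebesgue_integral_def
  proof (rule integral_nonneg_AE, rule AE_I2)
    fix x have "(u x)\<^sup>2 - 2 * a * u x + a\<^sup>2 = (u x - a)\<^sup>2" by (simp add: power2_diff)
    then show "0 \<le> indicator S x *\<^sub>R ((u x)\<^sup>2 - 2 * a * u x + a\<^sup>2)" by simp
  qed
  also have "\<dots> = (LINT x:S|M. (u x)\<^sup>2) - 2 * a * (LINT x:S|M. u x) + a\<^sup>2 * measure M S"
    using u const S by (simp add: set_integral_add set_integral_diff set_integral_const)
  also have "\<dots> = (LINT x:S|M. (u x)\<^sup>2) - (LINT x:S|M. u x)\<^sup>2 / measure M S"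
    using False by (simp add: a_def power2_eq_square field_simps)
  finally show ?thesis
    using False by (simp add: field_simps zero_less_measure_iff)
qed

context real_tree
begin

text \<open>The increment is a difference of integrals over two legs that make up
  \<open>tree_arc x y\<close> and share only the null set \<open>{c}\<close>. Absolute values merge
  them into one integral over \<open>tree_arc x y\<close>, to which Cauchy-Schwarz applies.\<close>

lemma gradient_oscillation:
  assumes compact: "compact (UNIV :: 'a set)"
    and g: "has_gradient \<rho> f g" "square_integrable length_measure g"
  shows "(f y - f (x::'a))\<^sup>2 \<le> dist x y * (\<integral>z. (g z)\<^sup>2 \<partial>length_measure)"
proof -
  let ?L = "length_measure :: 'a measure"
  define c where "c = branch_point \<rho> x y"
  note split = tree_arc_split[where x = \<rho> and y = x and z = y, folded c_def]
  have sets_L [measurable_cong]: "sets ?L = sets borel"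
    using length_measure[OF compact] by (simp add: is_length_measure_def)
  have arc_meas: "tree_arc a b \<in> sets ?L" for a b :: 'a by (simp add: sets_L)
  have int: "set_integrable ?L (tree_arc a b) g" for a b
    using g(1) length_measure_tree_arc[OF compact, of a b] by (simp add: has_gradient_def loc_integrable_def)
  have int2: "integrable ?L (\<lambda>z. (g z)\<^sup>2)" using g(2) by (simp add: square_integrable_def)
  have int2': "set_integrable ?L (tree_arc x y) (\<lambda>z. (g z)\<^sup>2)"
    using integrable_mult_indicator[OF arc_meas int2] by (simp add: set_integrable_def)
  have AE: "AE z in ?L. \<not> (z \<in> tree_arc c x \<and> z \<in> tree_arc c y)"
    using length_measure_point[OF compact length_measure[OF compact], of c] split(2)
    by (intro AE_I'[of "{c}"]) auto
  have "\<bar>f y - f x\<bar> = \<bar>- (LINT z:tree_arc c x|?L. g z) + (LINT z:tree_arc c y|?L. g z)\<bar>"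
    using g(1) by (simp add: has_gradient_def tree_integral_def c_def)
  also have "\<dots> \<le> \<bar>LINT z:tree_arc c x|?L. g z\<bar> + \<bar>LINT z:tree_arc c y|?L. g z\<bar>"
    by linarith
  also have "\<dots> \<le> (LINT z:tree_arc c x|?L. \<bar>g z\<bar>) + (LINT z:tree_arc c y|?L. \<bar>g z\<bar>)"
    using set_integral_norm_bound[OF int, of c x] set_integral_norm_bound[OF int, of c y] by simp
  also have "\<dots> = (LINT z:tree_arc x y|?L. \<bar>g z\<bar>)"
    unfolding split(1) using set_integrable_abs[OF int, of c x] set_integrable_abs[OF int, of c y] arc_meas
    by (intro set_integral_Un_AE[symmetric] AE) auto
  finally have "(f y - f x)\<^sup>2 \<le> (LINT z:tree_arc x y|?L. \<bar>g z\<bar>)\<^sup>2"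
    by (simp add: abs_le_square_iff[symmetric])
  also have "\<dots> \<le> measure ?L (tree_arc x y) * (LINT z:tree_arc x y|?L. \<bar>g z\<bar>\<^sup>2)"
    using int2' set_integrable_abs[OF int] length_measure_tree_arc[OF compact]
    by (intro set_integral_power2_le arc_meas) simp_all
  also have "\<dots> \<le> dist x y * (\<integral>z. (g z)\<^sup>2 \<partial>?L)"
    using length_measure_tree_arc[OF compact, of x y] int2 int2'
    by (intro mult_mono) (auto simp: measure_def set_lebesgue_integral_def set_integrable_def
      intro!: integral_mono integral_nonneg_AE split: split_indicator)
  finally show ?thesis .
qed

lemma energy_form_oscillation:
  assumes "compact (UNIV :: 'a set)" "f \<in> form_domain \<rho> \<nu>"
  shows "(f y - f (x::'a))\<^sup>2 \<le> 2 * diameter (UNIV :: 'a set) * energy_form \<rho> f f"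
proof -
  have "(f y - f x)\<^sup>2 \<le> dist x y * (\<integral>z. (gradient \<rho> f z)\<^sup>2 \<partial>length_measure)"
    using assms by (intro gradient_oscillation) (auto simp: form_domain_def finite_energy_def)
  also have "\<dots> \<le> diameter (UNIV :: 'a set) * (\<integral>z. (gradient \<rho> f z)\<^sup>2 \<partial>length_measure)"
    using assms(1) by (intro mult_right_mono diameter_bounded_bound compact_imp_bounded) auto
  finally show ?thesis by (simp add: energy_form_def power2_eq_square)
qed

end

section \<open>Decreasing convex functions\<close>

lemma antimono_imp_tendsto_at_right:
  fixes f :: "real \<Rightarrow> real"
  assumes anti: "\<And>s t. 0 < s \<Longrightarrow> s \<le> t \<Longrightarrow> f t \<le> f s" and bdd: "\<And>t. 0 < t \<Longrightarrow> f t \<le> K"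
  shows "(f \<longlongrightarrow> (SUP t\<in>{0<..}. f t)) (at_right 0)"
proof (rule order_tendstoI)
  have bddA: "bdd_above (f ` {0<..})" using bdd by (auto simp: bdd_above_def)
  fix a assume "a < (SUP t\<in>{0<..}. f t)"
  then obtain t where t: "0 < t" "a < f t" using less_cSUP_iff[OF _ bddA, of a] by auto
  show "eventually (\<lambda>s. a < f s) (at_right 0)"
    unfolding eventually_at_right_field using t anti
    by (intro exI[of _ t]) (auto intro: less_le_trans less_imp_le)
next
  have bddA: "bdd_above (f ` {0<..})" using bdd by (auto simp: bdd_above_def)
  fix a assume "(SUP t\<in>{0<..}. f t) < a"
  then have "f s < a" if "0 < s" for s
    using cSUP_upper[OF _ bddA, of s] that by auto
  then show "eventually (\<lambda>s. f s < a) (at_right 0)"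
    unfolding eventually_at_right_field by (intro exI[of _ 1]) auto
qed

text \<open>The increments of \<open>a\<close> are nondecreasing, so the mean of the first
  \<open>k\<close> of them is at most each later one.\<close>

lemma midpoint_convex_sequence:
  fixes a :: "nat \<Rightarrow> real"
  assumes conv: "\<And>k. 2 * a (Suc k) \<le> a k + a (Suc (Suc k))" and "k \<le> n"
  shows "n * (a k - a 0) \<le> k * (a n - a 0)"
proof -
  have mono: "a (Suc i) - a i \<le> a (Suc j) - a j" if "i \<le> j" for i j
    using that
  proof (induction rule: dec_induct)
    case (step j) then show ?case using conv[of j] by simp
  qed simp
  have "k * (a (k + m) - a k) \<ge> m * (a k - a 0)" for m
  proof (induction m)
    case (Suc m)
    have "a k - a 0 = (\<Sum>i<k. a (Suc i) - a i)" by (simp add: sum_lessThan_telescope)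
    also have "\<dots> \<le> (\<Sum>i<k. a (Suc (k + m)) - a (k + m))" by (intro sum_mono mono) auto
    finally have "a k - a 0 \<le> k * (a (Suc (k + m)) - a (k + m))" by simp
    then show ?case using Suc.IH by (simp add: algebra_simps)
  qed simp
  from this[of "n - k"] assms(2) show ?thesis by (simp add: of_nat_diff algebra_simps)
qed

text \<open>The model is the map from \<open>t\<close> to (f, P_t f) for a symmetric semigroup. No
  differentiability is assumed; one-sided difference quotients take the place of
  derivatives.\<close>

locale decreasing_midpoint_convex =
  fixes \<phi> :: "real \<Rightarrow> real"
  assumes nonneg: "\<And>t. 0 \<le> t \<Longrightarrow> 0 \<le> \<phi> t"
    and antimono: "\<And>s t. 0 \<le> s \<Longrightarrow> s \<le> t \<Longrightarrow> \<phi> t \<le> \<phi> s"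
    and midpoint: "\<And>s t. 0 \<le> s \<Longrightarrow> 0 \<le> t \<Longrightarrow> 2 * \<phi> ((s + t) / 2) \<le> \<phi> s + \<phi> t"
begin

text \<open>Midpoint convexity gives convexity at the rational weights \<open>\<lfloor>n l\<rfloor> / n \<le> l\<close>; monotonicity
  lets them tend to \<open>l\<close>.\<close>

lemma convex:
  assumes x: "0 \<le> x" and h: "0 \<le> h" and l: "0 \<le> l" "l \<le> 1"
  shows "\<phi> (x + l * h) \<le> \<phi> x + l * (\<phi> (x + h) - \<phi> x)"
proof -
  define r where "r n = real (nat \<lfloor>real (Suc n) * l\<rfloor>) / real (Suc n)" for n
  have r: "l - 1 / Suc n \<le> r n" "r n \<le> l" for n
  proof -
    let ?N = "real (Suc n)"
    have f: "?N * l - 1 \<le> real (nat \<lfloor>?N * l\<rfloor>)" "real (nat \<lfloor>?N * l\<rfloor>) \<le> ?N * l"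
      using l zero_le_mult_iff[of ?N l] by linarith+
    have "(?N * l - 1) / ?N \<le> r n" "r n \<le> ?N * l / ?N"
      using f[THEN divide_right_mono[where c = ?N]] unfolding r_def by simp_all
    then show "l - 1 / Suc n \<le> r n" "r n \<le> l" by (simp_all add: diff_divide_distrib)
  qed
  have bound: "\<phi> (x + l * h) \<le> \<phi> x + r n * (\<phi> (x + h) - \<phi> x)" for n
  proof -
    define q where "q = h / Suc n"
    have q: "0 \<le> q" using h by (simp add: q_def)
    define a where "a k = \<phi> (x + real k * q)" for k
    define k where "k = nat \<lfloor>real (Suc n) * l\<rfloor>"
    have "real k \<le> real (Suc n) * l" using l by (simp add: k_def)
    also have "\<dots> \<le> real (Suc n)" using l mult_left_mono[of l 1 "real (Suc n)"] by simp
    finally have kn: "k \<le> Suc n" by simp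
    have "2 * a (Suc j) \<le> a j + a (Suc (Suc j))" for j
    proof -
      have "x + real (Suc j) * q = ((x + real j * q) + (x + real (Suc (Suc j)) * q)) / 2"
        by (simp add: field_simps)
      then show ?thesis unfolding a_def
        using midpoint[of "x + real j * q" "x + real (Suc (Suc j)) * q"] x q
        by (metis add_nonneg_nonneg mult_nonneg_nonneg of_nat_0_le_iff)
    qed
    then have "real (Suc n) * (a k - a 0) \<le> k * (a (Suc n) - a 0)"
      using kn by (rule midpoint_convex_sequence)
    then have "a k \<le> a 0 + r n * (a (Suc n) - a 0)"
      unfolding r_def k_def[symmetric] by (simp add: field_simps)
    moreover have "a k = \<phi> (x + r n * h)" "a 0 = \<phi> x" "a (Suc n) = \<phi> (x + h)"
      by (simp_all add: a_def r_def k_def q_def)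
    moreover have "\<phi> (x + l * h) \<le> \<phi> (x + r n * h)"
    proof (rule antimono)
      show "0 \<le> x + r n * h" using x h by (simp add: r_def)
      show "x + r n * h \<le> x + l * h" using r(2) h by (simp add: mult_right_mono)
    qed
    ultimately show ?thesis by simp
  qed
  have lim: "r \<longlonglongrightarrow> l"
  proof (rule tendsto_sandwich)
    show "(\<lambda>n. l - 1 / Suc n) \<longlonglongrightarrow> l"
      using tendsto_diff[OF tendsto_const LIMSEQ_inverse_real_of_nat, of l] by (simp add: divide_inverse)
  qed (use r in auto)
  have "(\<lambda>n. \<phi> x + r n * (\<phi> (x + h) - \<phi> x)) \<longlonglongrightarrow> \<phi> x + l * (\<phi> (x + h) - \<phi> x)"
    by (intro tendsto_intros lim)
  then show ?thesis using bound by (intro LIMSEQ_le_const) auto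
qed

text \<open>For \<open>c > 0\<close> this is minus the right derivative of \<open>\<phi>\<close> at
  \<open>c\<close>: the quotients grow as \<open>t\<close> decreases to 0, so their limit is a
  supremum. For the semigroup it becomes the energy of P_{c/2} f.\<close>

definition decay :: "real \<Rightarrow> real" where
  "decay c = (SUP t\<in>{0<..}. (\<phi> c - \<phi> (c + t)) / t)"

lemma difference_quotient_antimono:
  assumes "0 \<le> c" "0 < s" "s \<le> t"
  shows "(\<phi> c - \<phi> (c + t)) / t \<le> (\<phi> c - \<phi> (c + s)) / s"
  using convex[of c t "s / t"] assms by (simp add: field_simps)

text \<open>\<open>c\<close> is a convex combination of \<open>b\<close> and \<open>c + t\<close>,
  and slopes of a convex function are ordered. With \<open>b = 0\<close> this also bounds the
  quotients in \<open>decay c\<close>.\<close>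

lemma difference_quotient_le:
  assumes "0 \<le> b" "b < c" "0 < t"
  shows "(\<phi> c - \<phi> (c + t)) / t \<le> (\<phi> b - \<phi> c) / (c - b)"
proof -
  have "\<phi> (b + ((c - b) / (c - b + t)) * (c - b + t))
      \<le> \<phi> b + ((c - b) / (c - b + t)) * (\<phi> (b + (c - b + t)) - \<phi> b)"
    using assms by (intro convex) auto
  then have "\<phi> c \<le> \<phi> b + ((c - b) / (c - b + t)) * (\<phi> (c + t) - \<phi> b)"
    using assms by (simp add: add.commute)
  then show ?thesis using assms by (simp add: field_simps)
qed

lemma decay_tendsto:
  assumes "0 < c"
  shows "((\<lambda>t. (\<phi> c - \<phi> (c + t)) / t) \<longlongrightarrow> decay c) (at_right 0)"
  unfolding decay_def
  using difference_quotient_le[of 0 c] assms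
  by (intro antimono_imp_tendsto_at_right difference_quotient_antimono) auto

lemma decay_le:
  assumes "0 \<le> b" "b < c"
  shows "decay c * (c - b) \<le> \<phi> b - \<phi> c"
proof -
  have "decay c \<le> (\<phi> b - \<phi> c) / (c - b)"
    unfolding decay_def using difference_quotient_le[OF assms] by (intro cSUP_least) auto
  then show ?thesis using assms by (simp add: field_simps)
qed

text \<open>An implicit Euler step: the decay rate at the right end \<open>c\<close> bounds from
  below the drop over the whole interval from \<open>b\<close> to \<open>c\<close>.\<close>

lemma decay_linear_bound:
  assumes lam: "\<And>c. 0 < c \<Longrightarrow> l * \<phi> c \<le> decay c" and "0 \<le> b" "b \<le> c"
  shows "\<phi> c * (1 + l * (c - b)) \<le> \<phi> b"
proof (cases "b = c")
  case False
  then have "l * \<phi> c * (c - b) \<le> decay c * (c - b)"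
    using assms by (intro mult_right_mono) auto
  also have "\<dots> \<le> \<phi> b - \<phi> c"
    using decay_le[of b c] False assms by simp
  finally have "l * \<phi> c * (c - b) \<le> \<phi> b - \<phi> c" .
  then show ?thesis by (simp add: algebra_simps)
qed simp

text \<open>The solution of \<open>y' = - y\<^sup>2 / K\<close> with \<open>y 0 = \<infinity>\<close> is \<open>K / t\<close>, and dominates every \<open>\<phi>\<close> with
  \<open>- \<phi>' \<ge> \<phi>\<^sup>2 / K\<close>.\<close>

lemma decay_quadratic_bound:
  assumes quad: "\<And>c. 0 < c \<Longrightarrow> (\<phi> c)\<^sup>2 \<le> K * decay c" and K: "0 < K" and c: "0 < c"
  shows "\<phi> c * c \<le> K"
proof (cases "\<phi> c = 0")
  case False
  then have pos: "0 < \<phi> c" using nonneg[of c] c by simp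
  \<comment> \<open>\<open>M = \<phi> 0 / a\<close> serves as a Lipschitz constant from time
    \<open>a\<close> on, so the comparison starts at \<open>a > 0\<close>; at the end
    \<open>a\<close> tends to 0.\<close>
  have *: "\<phi> c * (c - a) \<le> K" if a: "0 < a" "a < c" for a
  proof -
    define M where "M = \<phi> 0 / a"
    have M: "0 \<le> M" using nonneg[of 0] a by (simp add: M_def)
    \<comment> \<open>\<open>1 / \<phi>\<close> grows at least at rate \<open>1 / K\<close>, up to a
      relative error of order \<open>d\<close> that comes from evaluating the decay at
      \<open>x + d\<close>.\<close>
    have step: "d / K * (1 - M * d / \<phi> c) \<le> 1 / \<phi> (x + d) - 1 / \<phi> x"
      if "a \<le> x" "0 \<le> d" "x + d \<le> c" for x d
    proof (cases "d = 0")
      case False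
      have px: "\<phi> c \<le> \<phi> (x + d)" "\<phi> (x + d) \<le> \<phi> x" using that a by (auto intro: antimono)
      have "(\<phi> x - \<phi> (x + d)) / d \<le> (\<phi> 0 - \<phi> x) / x"
        using difference_quotient_le[of 0 x d] that a False by simp
      also have "\<dots> \<le> \<phi> 0 / a"
        using that a pos px nonneg[of 0] by (intro frac_le) auto
      finally have lip: "\<phi> x - \<phi> (x + d) \<le> M * d"
        using False that by (simp add: M_def field_simps)
      have "1 - M * d / \<phi> c \<le> 1 - M * d / \<phi> x"
        using px pos M that by (simp add: frac_le)
      also have "\<dots> = (\<phi> x - M * d) / \<phi> x"
        using px pos by (simp add: diff_divide_distrib)
      also have "\<dots> \<le> \<phi> (x + d) / \<phi> x"
        using lip px pos by (intro divide_right_mono) auto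
      finally have r: "1 - M * d / \<phi> c \<le> \<phi> (x + d) / \<phi> x" .
      have "(\<phi> (x + d))\<^sup>2 * d \<le> K * decay (x + d) * d"
        using quad[of "x + d"] that a by (intro mult_right_mono) auto
      also have "\<dots> \<le> K * (\<phi> x - \<phi> (x + d))"
        using decay_le[of x "x + d"] that a False K by (simp add: mult.assoc)
      finally have main: "(\<phi> (x + d))\<^sup>2 * d / K \<le> \<phi> x - \<phi> (x + d)"
        using K by (simp add: field_simps)
      have "d / K * (1 - M * d / \<phi> c) \<le> d / K * (\<phi> (x + d) / \<phi> x)"
        using r K that by (intro mult_left_mono) auto
      also have "\<dots> = ((\<phi> (x + d))\<^sup>2 * d / K) / (\<phi> x * \<phi> (x + d))"
        using px pos by (simp add: power2_eq_square field_simps)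
      also have "\<dots> \<le> (\<phi> x - \<phi> (x + d)) / (\<phi> x * \<phi> (x + d))"
        using px pos main by (intro divide_right_mono) auto
      also have "\<dots> = 1 / \<phi> (x + d) - 1 / \<phi> x"
        using px pos by (simp add: field_simps)
      finally show ?thesis .
    qed simp
    \<comment> \<open>The sum over \<open>Suc n\<close> equal steps from \<open>a\<close> to
      \<open>c\<close> telescopes, and the error vanishes as \<open>n\<close> grows.\<close>
    have "(c - a) / K * (1 - M * ((c - a) / Suc n) / \<phi> c) \<le> 1 / \<phi> c" for n
    proof -
      define d where "d = (c - a) / Suc n"
      have d: "0 \<le> d" "a + real (Suc n) * d = c" using a by (simp_all add: d_def)
      have "real (Suc n) * (d / K * (1 - M * d / \<phi> c)) = (\<Sum>i<Suc n. d / K * (1 - M * d / \<phi> c))"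
        by simp
      also have "\<dots> \<le> (\<Sum>i<Suc n. 1 / \<phi> (a + real (Suc i) * d) - 1 / \<phi> (a + real i * d))"
      proof (rule sum_mono)
        fix i assume "i \<in> {..<Suc n}"
        then have "real (Suc i) * d \<le> real (Suc n) * d" using d by (intro mult_right_mono) auto
        then show "d / K * (1 - M * d / \<phi> c) \<le> 1 / \<phi> (a + real (Suc i) * d) - 1 / \<phi> (a + real i * d)"
          using step[of "a + real i * d" d] d by (simp add: algebra_simps)
      qed
      also have "\<dots> = 1 / \<phi> c - 1 / \<phi> a"
        using d by (subst sum_lessThan_telescope) simp
      also have "\<dots> \<le> 1 / \<phi> c" using nonneg[of a] a by simp
      finally show ?thesis using d a by (simp add: d_def mult.assoc[symmetric])
    qed
    moreover have "(\<lambda>n. (c - a) / K * (1 - M * ((c - a) / Suc n) / \<phi> c))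
        \<longlonglongrightarrow> (c - a) / K * (1 - M * ((c - a) * 0) / \<phi> c)"
      unfolding divide_inverse[of _ "real (Suc _)"]
      using pos by (intro tendsto_intros LIMSEQ_inverse_real_of_nat) auto
    ultimately have "(c - a) / K \<le> 1 / \<phi> c"
      by (intro LIMSEQ_le_const2) auto
    then show ?thesis using K pos by (simp add: field_simps)
  qed
  \<comment> \<open>The starting point \<open>c / Suc (Suc n)\<close> lies strictly below
    \<open>c\<close> for every \<open>n\<close>, also for \<open>n = 0\<close>.\<close>
  have "\<phi> c * (c - c / Suc (Suc n)) \<le> K" for n
    by (rule *) (use c in \<open>simp_all add: divide_less_eq\<close>)
  moreover have "(\<lambda>n. \<phi> c * (c - c / Suc (Suc n))) \<longlonglongrightarrow> \<phi> c * (c - c * 0)"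
    unfolding divide_inverse
    by (intro tendsto_intros LIMSEQ_Suc[OF LIMSEQ_inverse_real_of_nat])
  ultimately have "\<phi> c * (c - c * 0) \<le> K" by (intro LIMSEQ_le_const2) auto
  then show ?thesis by simp
qed (use K in simp)

lemma decay_nonneg:
  assumes "0 < c" shows "0 \<le> decay c"
  using antimono[of c] assms
  by (intro tendsto_lowerbound[OF decay_tendsto[OF assms]])
    (auto simp: eventually_at_right_field intro!: exI[of _ 1])

text \<open>With \<open>n\<close> implicit Euler steps the factor is (1 + l (c - b) / n)^n, which
  tends to the exponential.\<close>

lemma decay_exponential_bound:
  assumes lam: "\<And>c. 0 < c \<Longrightarrow> l * \<phi> c \<le> decay c" and l: "0 \<le> l" and b: "0 \<le> b" "b \<le> c"
  shows "\<phi> c * exp (l * (c - b)) \<le> \<phi> b"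
proof -
  have step: "\<phi> (b + real j * d) * (1 + l * d) ^ j \<le> \<phi> b" if "0 \<le> d" for j d
  proof (induction j)
    case (Suc j)
    have "\<phi> (b + real (Suc j) * d) * (1 + l * d) ^ Suc j
        = \<phi> (b + real (Suc j) * d) * (1 + l * ((b + real (Suc j) * d) - (b + real j * d))) * (1 + l * d) ^ j"
      by (simp add: algebra_simps)
    also have "\<dots> \<le> \<phi> (b + real j * d) * (1 + l * d) ^ j"
      using that l b by (intro mult_right_mono decay_linear_bound lam) (auto simp: algebra_simps)
    finally show ?case using Suc.IH by simp
  qed simp
  have "\<phi> c * (1 + l * (c - b) / real n) ^ n \<le> \<phi> b" if "1 \<le> n" for n
    using step[of "(c - b) / real n" n] that b by simp
  moreover have "(\<lambda>n. \<phi> c * (1 + l * (c - b) / real n) ^ n) \<longlonglongrightarrow> \<phi> c * exp (l * (c - b))"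
    by (intro tendsto_intros tendsto_exp_limit_sequentially)
  ultimately show ?thesis by (intro LIMSEQ_le_const2) auto
qed

text \<open>Here \<open>V\<close> is a total variation distance and \<open>m * \<phi> (2 * t)\<close> the corresponding \<open>\<chi>\<^sup>2\<close>-distance.
  Up to the time \<open>D * m\<close> the bound \<open>1 / (1 + t / (D * m))\<close> given by the quadratic decay is good enough;
  afterwards the spectral gap takes over.\<close>

lemma total_variation_decay:
  assumes m: "0 < m" and D: "0 \<le> D" and t: "0 \<le> t"
    and quad: "\<And>c. 0 < c \<Longrightarrow> (\<phi> c)\<^sup>2 \<le> 2 * D * decay c"
    and lin: "\<And>c. 0 < c \<Longrightarrow> \<phi> c \<le> m * D / 2 * decay c"
    and V: "0 \<le> V" "V \<le> 1" "V\<^sup>2 \<le> m * \<phi> (2 * t) / 4"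
    and V2: "1 / 2 \<le> V \<Longrightarrow> V * (1 + m * \<phi> (2 * t)) \<le> m * \<phi> (2 * t)"
  shows "V \<le> exp (- t / (2 * D * m))"
\<comment> \<open>For \<open>D = 0\<close>, division by zero makes the exponent 0; as for
  \<open>t = 0\<close>, the claim is then \<open>V \<le> 1\<close>.\<close>
proof (cases "D = 0 \<or> t = 0")
  case False
  with D t have D: "0 < D" and t: "0 < t" by auto
  \<comment> \<open>In units of \<open>D * m\<close> the claimed bound is
    \<open>exp (- \<tau> / 2)\<close>.\<close>
  define \<tau> where "\<tau> = t / (D * m)"
  have \<tau>: "0 < \<tau>" "t = \<tau> * (D * m)" using m D t by (simp_all add: \<tau>_def)
  define w where "w = m * \<phi> (2 * t)"
  have K: "\<phi> c * c \<le> 2 * D" if "0 < c" for c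
    using decay_quadratic_bound[OF quad, of c] D that by simp
  have "V \<le> exp (- \<tau> / 2)"
  proof (cases "\<tau> \<le> 1")
    case True
    show ?thesis
    proof (cases "1 / 2 \<le> V")
      case True
      have "\<tau> * w = \<phi> (2 * t) * (2 * t) / (2 * D)" using m D by (simp add: w_def \<tau>_def)
      also have "\<dots> \<le> 1" using K[of "2 * t"] t D by simp
      finally have w: "\<tau> * w \<le> 1" .
      \<comment> \<open>Together with \<open>\<tau> * w \<le> 1\<close> this gives
        \<open>V \<le> 1 / (1 + \<tau>)\<close>, and
        \<open>exp (\<tau> / 2) \<le> 1 + \<tau>\<close> for \<open>\<tau> \<le> 1\<close>.\<close>
      have "V \<le> w * (1 - V)" using V2[OF True] by (simp add: w_def algebra_simps)
      then have "\<tau> * V \<le> \<tau> * w * (1 - V)" using \<tau>(1) by (simp add: mult.assoc)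
      also have "\<dots> \<le> 1 * (1 - V)" using w V by (intro mult_right_mono) auto
      finally have "V * (1 + \<tau>) \<le> 1" by (simp add: algebra_simps)
      have "exp (\<tau> / 2) \<le> 1 + \<tau> / 2 + (\<tau> / 2)\<^sup>2"
        using \<tau>(1) \<open>\<tau> \<le> 1\<close> by (intro exp_bound) auto
      also have "(\<tau> / 2)\<^sup>2 \<le> \<tau> / 2"
        unfolding power2_eq_square using \<tau>(1) \<open>\<tau> \<le> 1\<close> by (intro mult_left_le) auto
      also have "1 + \<tau> / 2 + \<tau> / 2 = 1 + \<tau>" by simp
      finally have "V * exp (\<tau> / 2) \<le> V * (1 + \<tau>)" using V by (intro mult_left_mono) auto
      then have "V * exp (\<tau> / 2) \<le> 1" using \<open>V * (1 + \<tau>) \<le> 1\<close> by linarith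
      then show ?thesis by (simp add: exp_minus field_simps)
    next
      case False
      \<comment> \<open>Here \<open>V < 1 / 2 \<le> 1 - \<tau> / 2\<close>, because
        \<open>\<tau> \<le> 1\<close>.\<close>
      have "1 + - \<tau> / 2 \<le> exp (- \<tau> / 2)" by (rule exp_ge_add_one_self)
      then show ?thesis using False \<open>\<tau> \<le> 1\<close> by simp
    qed
  next
    case False
    \<comment> \<open>\<open>lin\<close> acts as a spectral gap \<open>2 / (m * D)\<close>.
      Exponential decay starts at \<open>2 * (D * m)\<close>, where the quadratic bound has already
      brought \<open>m * \<phi>\<close> down to at most 1.\<close>
    have "2 / (m * D) * \<phi> c \<le> decay c" if "0 < c" for c
      using lin[OF that] m D by (simp add: field_simps)
    then have "\<phi> (2 * t) * exp (2 / (m * D) * (2 * t - 2 * (D * m))) \<le> \<phi> (2 * (D * m))"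
    proof (rule decay_exponential_bound)
      have "1 * (D * m) \<le> \<tau> * (D * m)" using False m D by (intro mult_right_mono) auto
      then show "2 * (D * m) \<le> 2 * t" using \<tau>(2) by simp
    qed (use m D in auto)
    also have "2 / (m * D) * (2 * t - 2 * (D * m)) = 4 * (\<tau> - 1)"
      using m D by (simp add: \<tau>_def field_simps)
    finally have "m * (\<phi> (2 * t) * exp (4 * (\<tau> - 1))) \<le> m * \<phi> (2 * (D * m))"
      using m by (intro mult_left_mono) auto
    also have "\<dots> \<le> 1" using K[of "2 * (D * m)"] m D by (simp add: mult.commute)
    finally have 1: "w * exp (4 * (\<tau> - 1)) \<le> 1" by (simp add: w_def mult.assoc)
    have w0: "0 \<le> w" using m t nonneg[of "2 * t"] by (simp add: w_def)
    \<comment> \<open>Rate 1 in \<open>\<tau>\<close> suffices, since only the square of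
      \<open>V\<close> is bounded by \<open>w\<close>; the remaining constant
      \<open>exp 1 / 4\<close> is below 1.\<close>
    have "w * exp (\<tau> - 1) \<le> w * exp (4 * (\<tau> - 1))"
      using False w0 by (intro mult_left_mono) auto
    then have "w * exp (\<tau> - 1) * exp (1 - \<tau>) \<le> 1 * exp (1 - \<tau>)"
      using 1 by (intro mult_right_mono) auto
    then have "w \<le> exp (1 - \<tau>)" by (simp add: mult.assoc flip: exp_add)
    moreover have "exp (1 - \<tau>) = exp 1 * exp (- \<tau>)" by (simp flip: exp_add)
    ultimately have "V\<^sup>2 \<le> exp 1 * exp (- \<tau>) / 4" using V(3) by (simp add: w_def)
    also have "\<dots> \<le> exp (- \<tau>)" using exp_le by simp
    also have "\<dots> = (exp (- \<tau> / 2))\<^sup>2" by (simp add: power2_eq_square flip: exp_add)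
    finally show ?thesis by (rule power2_le_imp_le) simp
  qed
  then show ?thesis by (simp add: \<tau>_def mult.assoc mult.left_commute mult.commute)
qed (use V in auto)

end

section \<open>Symmetric Markov kernels\<close>

text \<open>Of the process only its one-time laws \<open>k t x\<close> are retained. Symmetry is
  stated for nonnegative extended functions and transferred below to bounded real ones.\<close>

locale symmetric_markov_kernels = finite_measure M
  for M :: "'b::topological_space measure" +
  fixes k :: "real \<Rightarrow> 'b \<Rightarrow> 'b measure"
  assumes sets_M [measurable_cong]: "sets M = sets borel"
    and kernel: "\<And>t. 0 \<le> t \<Longrightarrow> k t \<in> borel \<rightarrow>\<^sub>M prob_algebra borel"
    and chapman_kolmogorov: "\<And>s t x A. 0 \<le> s \<Longrightarrow> 0 \<le> t \<Longrightarrow> A \<in> sets borel \<Longrightarrow>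
      measure (k (s + t) x) A = (\<integral>y. measure (k t y) A \<partial>k s x)"
    and kernel_symmetric: "\<And>t f g. 0 \<le> t \<Longrightarrow> f \<in> borel_measurable borel \<Longrightarrow> g \<in> borel_measurable borel \<Longrightarrow>
      (\<integral>\<^sup>+x. f x * (\<integral>\<^sup>+y. g y \<partial>k t x) \<partial>M) = (\<integral>\<^sup>+x. (\<integral>\<^sup>+y. f y \<partial>k t x) * g x \<partial>M)"
begin

text \<open>Such functions are defined everywhere and not just up to null sets, remain bounded under
  \<open>op\<close>, and are integrable together with their products because \<open>M\<close> is
  finite.\<close>

definition bounded_borel :: "('b \<Rightarrow> real) \<Rightarrow> bool" where
  "bounded_borel f \<longleftrightarrow> f \<in> borel_measurable borel \<and> (\<exists>C. \<forall>x. \<bar>f x\<bar> \<le> C)"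

definition op :: "real \<Rightarrow> ('b \<Rightarrow> real) \<Rightarrow> 'b \<Rightarrow> real" where
  "op t f x = (\<integral>y. f y \<partial>k t x)"

lemma space_M [simp]: "space M = UNIV"
  using sets_eq_imp_space_eq[OF sets_M] by simp

lemma kernel_space:
  assumes "0 \<le> t"
  shows "prob_space (k t x)" "sets (k t x) = sets borel"
  using measurable_space[OF kernel[OF assms], of x] by (auto simp: space_prob_algebra)

lemma kernel_subprob: "0 \<le> t \<Longrightarrow> k t \<in> borel \<rightarrow>\<^sub>M subprob_algebra borel"
  by (rule measurable_prob_algebraD[OF kernel])

lemma bounded_borelD [measurable_dest]: "bounded_borel f \<Longrightarrow> f \<in> borel_measurable borel"
  by (simp add: bounded_borel_def)

lemma bounded_borel_bound:
  assumes "bounded_borel f" shows "\<exists>C\<ge>0. \<forall>x. \<bar>f x\<bar> \<le> C"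
  using assms unfolding bounded_borel_def by (metis abs_ge_zero order_trans)

lemma bounded_borel_const [simp]: "bounded_borel (\<lambda>_. c)"
  by (auto simp: bounded_borel_def)

lemma bounded_borel_add [simp]: "bounded_borel f \<Longrightarrow> bounded_borel g \<Longrightarrow> bounded_borel (\<lambda>x. f x + g x)"
  unfolding bounded_borel_def by (auto intro: order_trans[OF abs_triangle_ineq add_mono])

lemma bounded_borel_mult [simp]: "bounded_borel f \<Longrightarrow> bounded_borel g \<Longrightarrow> bounded_borel (\<lambda>x. f x * g x)"
proof -
  assume f: "bounded_borel f" and g: "bounded_borel g"
  obtain C where C: "0 \<le> C" "\<And>x. \<bar>f x\<bar> \<le> C" using bounded_borel_bound[OF f] by blast
  obtain D where D: "\<And>x. \<bar>g x\<bar> \<le> D" using bounded_borel_bound[OF g] by blast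
  have "\<bar>f x * g x\<bar> \<le> C * D" for x
    unfolding abs_mult using C D by (intro mult_mono) auto
  then show "bounded_borel (\<lambda>x. f x * g x)" using f g by (auto simp: bounded_borel_def)
qed

lemma bounded_borel_diff [simp]: "bounded_borel f \<Longrightarrow> bounded_borel g \<Longrightarrow> bounded_borel (\<lambda>x. f x - g x)"
  using bounded_borel_add[of f "\<lambda>x. -1 * g x"] bounded_borel_mult[of "\<lambda>_. -1" g] by simp

lemma bounded_borel_abs [simp]: "bounded_borel f \<Longrightarrow> bounded_borel (\<lambda>x. \<bar>f x\<bar>)"
  by (auto simp: bounded_borel_def)

lemma bounded_borel_power2 [simp]: "bounded_borel f \<Longrightarrow> bounded_borel (\<lambda>x. (f x)\<^sup>2)"
  by (simp add: power2_eq_square)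

lemma bounded_borel_indicator [simp]: "A \<in> sets borel \<Longrightarrow> bounded_borel (indicator A)"
  by (auto simp: bounded_borel_def indicator_def intro!: exI[of _ 1])

lemma integrable_bounded_borel [simp]:
  assumes "bounded_borel f" shows "integrable M f"
proof -
  obtain C where "\<And>x. \<bar>f x\<bar> \<le> C" using bounded_borel_bound[OF assms] by blast
  then show ?thesis using assms by (intro integrable_const_bound[where B = C]) (auto simp: bounded_borel_def)
qed

lemma integrable_kernel [simp]:
  assumes "0 \<le> t" "bounded_borel f" shows "integrable (k t x) f"
proof -
  interpret prob_space "k t x" by (rule kernel_space[OF assms(1)])
  have [measurable_cong]: "sets (k t x) = sets borel" by (rule kernel_space[OF assms(1)])
  obtain C where "\<And>x. \<bar>f x\<bar> \<le> C" using bounded_borel_bound[OF assms(2)] by blast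
  then show ?thesis using assms by (intro integrable_const_bound[where B = C]) (auto simp: bounded_borel_def)
qed

lemma op_const [simp]: "0 \<le> t \<Longrightarrow> op t (\<lambda>_. c) x = c"
  using prob_space.prob_space[OF kernel_space(1), of t x] by (simp add: op_def)

lemma op_add: "0 \<le> t \<Longrightarrow> bounded_borel f \<Longrightarrow> bounded_borel g \<Longrightarrow> op t (\<lambda>x. f x + g x) x = op t f x + op t g x"
  by (simp add: op_def)

lemma op_diff: "0 \<le> t \<Longrightarrow> bounded_borel f \<Longrightarrow> bounded_borel g \<Longrightarrow> op t (\<lambda>x. f x - g x) x = op t f x - op t g x"
  by (simp add: op_def)

lemma op_mono:
  "0 \<le> t \<Longrightarrow> bounded_borel f \<Longrightarrow> bounded_borel g \<Longrightarrow> (\<And>x. f x \<le> g x) \<Longrightarrow> op t f x \<le> op t g x"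
  unfolding op_def by (intro integral_mono) auto

lemma op_abs_le: "0 \<le> t \<Longrightarrow> bounded_borel f \<Longrightarrow> \<bar>op t f x\<bar> \<le> op t (\<lambda>x. \<bar>f x\<bar>) x"
  unfolding op_def by (rule integral_abs_bound)

text \<open>Jensen's inequality, as nonnegativity of the variance under
  \<open>k t x\<close>.\<close>

lemma op_power2_le:
  assumes "0 \<le> t" "bounded_borel f" shows "(op t f x)\<^sup>2 \<le> op t (\<lambda>x. (f x)\<^sup>2) x"
proof -
  interpret prob_space "k t x" by (rule kernel_space[OF assms(1)])
  show ?thesis
    using variance_positive[of f] variance_eq[of f] assms by (simp add: op_def)
qed

lemma bounded_borel_op [simp]:
  assumes "0 \<le> t" "bounded_borel f" shows "bounded_borel (op t f)"
proof -
  obtain C where C: "\<And>x. \<bar>f x\<bar> \<le> C" using bounded_borel_bound[OF assms(2)] by blast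
  have [measurable]: "f \<in> borel_measurable borel" using assms(2) by (rule bounded_borelD)
  have "\<bar>op t f x\<bar> \<le> C" for x
    using op_abs_le[OF assms, of x] op_mono[of t "\<lambda>x. \<bar>f x\<bar>" "\<lambda>_. C" x] assms C by simp
  moreover have "op t f \<in> borel_measurable borel"
    unfolding op_def by (rule measurable_compose[OF kernel_subprob[OF assms(1)] integral_measurable_subprob_algebra]) simp
  ultimately show ?thesis by (auto simp: bounded_borel_def)
qed

text \<open>Chapman-Kolmogorov on sets identifies \<open>k (s + t) x\<close> with the bind of
  \<open>k s x\<close> and \<open>k t\<close>; then \<open>f\<close> is integrated.\<close>

lemma op_semigroup:
  assumes s: "0 \<le> s" and t: "0 \<le> t" and f: "bounded_borel f"
  shows "op (s + t) f x = op s (op t f) x"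
proof -
  interpret S: prob_space "k s x" by (rule kernel_space[OF s])
  interpret ST: prob_space "k (s + t) x" using s t by (intro kernel_space) simp
  have st: "0 \<le> s + t" using s t by simp
  have sets: "sets (k s x) = sets borel" "sets (k (s + t) x) = sets borel"
    using kernel_space(2) s st by auto
  then have space: "space (k s x) \<noteq> {}" using sets_eq_imp_space_eq[OF sets(1)] by simp
  have k: "k t \<in> k s x \<rightarrow>\<^sub>M subprob_algebra borel"
    using kernel_subprob[OF t] sets(1) by (simp cong: measurable_cong_sets)
  have "k (s + t) x = k s x \<bind> k t"
  proof (rule measure_eqI)
    fix A assume "A \<in> sets (k (s + t) x)"
    then have A: "A \<in> sets borel" by (simp add: sets)
    have fin: "emeasure (k t y) A = ennreal (measure (k t y) A)" for y
      using kernel_space(1)[OF t] by (simp add: finite_measure.emeasure_eq_measure prob_space.finite_measure)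
    have "bounded_borel (op t (indicator A))" using A t by simp
    moreover have "op t (indicator A) = (\<lambda>y. measure (k t y) A)"
      using A kernel_space(2)[OF t] by (auto simp: op_def)
    ultimately have "integrable (k s x) (\<lambda>y. measure (k t y) A)" using s by (metis integrable_kernel)
    then have "emeasure (k s x \<bind> k t) A = ennreal (\<integral>y. measure (k t y) A \<partial>k s x)"
      unfolding emeasure_bind[OF space k A] fin by (intro nn_integral_eq_integral) auto
    then show "emeasure (k (s + t) x) A = emeasure (k s x \<bind> k t) A"
      using chapman_kolmogorov[OF s t A, of x] by (simp add: ST.emeasure_eq_measure)
  qed (use sets space k in \<open>simp add: sets_bind[OF sets_kernel[OF k]]\<close>)
  moreover obtain C where C: "\<And>x. \<bar>f x\<bar> \<le> C" using bounded_borel_bound[OF f] by blast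
  ultimately show ?thesis
    unfolding op_def using f k
    by (simp add: integral_bind[where K = borel and B = C and B' = 1] bounded_borelD S.finite_measure_axioms
      prob_space.emeasure_space_1[OF kernel_space(1)[OF t]])
qed

lemma integral_op_symmetric_nonneg:
  assumes t: "0 \<le> t" and f: "bounded_borel f" "\<And>x. 0 \<le> f x" and g: "bounded_borel g" "\<And>x. 0 \<le> g x"
  shows "(\<integral>x. f x * op t g x \<partial>M) = (\<integral>x. op t f x * g x \<partial>M)"
proof -
  have nn: "(\<integral>\<^sup>+y. ennreal (u y) \<partial>k t x) = ennreal (op t u x)" "0 \<le> op t u x"
    if "bounded_borel u" "\<And>x. 0 \<le> u x" for u x
    using that t unfolding op_def by (auto intro!: nn_integral_eq_integral)
  have "ennreal (\<integral>x. f x * op t g x \<partial>M) = (\<integral>\<^sup>+x. ennreal (f x * op t g x) \<partial>M)"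
    using f g t nn[of g] by (intro nn_integral_eq_integral[symmetric]) auto
  also have "\<dots> = (\<integral>\<^sup>+x. ennreal (f x) * (\<integral>\<^sup>+y. ennreal (g y) \<partial>k t x) \<partial>M)"
    using f g nn by (simp add: ennreal_mult)
  also have "\<dots> = (\<integral>\<^sup>+x. (\<integral>\<^sup>+y. ennreal (f y) \<partial>k t x) * ennreal (g x) \<partial>M)"
    using f g t by (intro kernel_symmetric) (auto dest!: bounded_borelD)
  also have "\<dots> = (\<integral>\<^sup>+x. ennreal (op t f x * g x) \<partial>M)"
    using f g nn by (simp add: ennreal_mult)
  also have "\<dots> = ennreal (\<integral>x. op t f x * g x \<partial>M)"
    using f g t nn[of f] by (intro nn_integral_eq_integral) auto
  finally show ?thesis
    using f g nn by (simp add: integral_nonneg_AE)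
qed

text \<open>Symmetry against the constant 1 makes \<open>M\<close> invariant; adding the bound
  \<open>C\<close> reduces the claim to nonnegative functions.\<close>

lemma integral_op:
  assumes t: "0 \<le> t" and f: "bounded_borel f"
  shows "(\<integral>x. op t f x \<partial>M) = (\<integral>x. f x \<partial>M)"
proof -
  obtain C where C: "0 \<le> C" "\<And>x. \<bar>f x\<bar> \<le> C" using bounded_borel_bound[OF f] by blast
  have "0 \<le> f x + C" for x using C(2)[of x] by linarith
  then have "(\<integral>x. op t (\<lambda>x. f x + C) x \<partial>M) = (\<integral>x. f x + C \<partial>M)"
    using integral_op_symmetric_nonneg[of t "\<lambda>x. f x + C" "\<lambda>_. 1"] t f by simp
  then show ?thesis using f t by (simp add: op_add)
qed

text \<open>Both functions are made nonnegative by adding constants; the extra terms agree on the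
  two sides by \<open>integral_op\<close>.\<close>

lemma integral_op_symmetric:
  assumes t: "0 \<le> t" and f: "bounded_borel f" and g: "bounded_borel g"
  shows "(\<integral>x. f x * op t g x \<partial>M) = (\<integral>x. op t f x * g x \<partial>M)"
proof -
  obtain C where C: "0 \<le> C" "\<And>x. \<bar>f x\<bar> \<le> C" using bounded_borel_bound[OF f] by blast
  obtain D where D: "0 \<le> D" "\<And>x. \<bar>g x\<bar> \<le> D" using bounded_borel_bound[OF g] by blast
  have "0 \<le> f x + C" "0 \<le> g x + D" for x using C(2)[of x] D(2)[of x] by linarith+
  then have "(\<integral>x. (f x + C) * op t (\<lambda>x. g x + D) x \<partial>M) = (\<integral>x. op t (\<lambda>x. f x + C) x * (g x + D) \<partial>M)"
    using t f g by (intro integral_op_symmetric_nonneg) auto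
  then show ?thesis
    using f g t by (simp add: op_add distrib_left distrib_right integral_op)
qed

text \<open>By invariance, \<open>op t\<close> of the distance between \<open>f\<close> and
  \<open>g\<close> has integral 0. This lets the semigroup act on representatives modulo null sets,
  as the form domain requires.\<close>

lemma op_cong_AE:
  assumes t: "0 \<le> t" and f: "bounded_borel f" and g: "bounded_borel g" and eq: "AE x in M. f x = g x"
  shows "AE x in M. op t f x = op t g x"
proof -
  let ?d = "\<lambda>x. \<bar>f x - g x\<bar>"
  have d: "bounded_borel ?d" using f g by simp
  have "(\<integral>x. op t ?d x \<partial>M) = (\<integral>x. ?d x \<partial>M)" using t d by (rule integral_op)
  also have "\<dots> = 0" using eq by (intro integral_eq_zero_AE) auto
  finally have "(\<integral>x. op t ?d x \<partial>M) = 0" .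
  moreover have "0 \<le> op t ?d x" for x unfolding op_def by simp
  ultimately have "AE x in M. op t ?d x = 0"
    using t d by (subst (asm) integral_nonneg_eq_0_iff_AE) auto
  then show ?thesis
  proof (rule AE_mp, intro AE_I2 impI)
    fix x assume "op t ?d x = 0"
    then show "op t f x = op t g x"
      using op_abs_le[of t "\<lambda>x. f x - g x" x] t f g by (simp add: op_diff)
  qed
qed

lemma integral_abs_op_le:
  assumes "0 \<le> t" "bounded_borel f"
  shows "(\<integral>x. \<bar>op t f x\<bar> \<partial>M) \<le> (\<integral>x. \<bar>f x\<bar> \<partial>M)"
  using integral_mono[of M "\<lambda>x. \<bar>op t f x\<bar>" "op t (\<lambda>x. \<bar>f x\<bar>)"] assms op_abs_le integral_op[of t "\<lambda>x. \<bar>f x\<bar>"]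
  by simp

lemma integral_power2_op_le:
  assumes "0 \<le> t" "bounded_borel f"
  shows "(\<integral>x. (op t f x)\<^sup>2 \<partial>M) \<le> (\<integral>x. (f x)\<^sup>2 \<partial>M)"
  using integral_mono[of M "\<lambda>x. (op t f x)\<^sup>2" "op t (\<lambda>x. (f x)\<^sup>2)"] assms op_power2_le integral_op[of t "\<lambda>x. (f x)\<^sup>2"]
  by simp

lemma integral_op_add:
  assumes "0 \<le> s" "0 \<le> t" "bounded_borel f"
  shows "(\<integral>x. f x * op (s + t) f x \<partial>M) = (\<integral>x. op s f x * op t f x \<partial>M)"
  using integral_op_symmetric[of s f "op t f"] assms by (simp add: op_semigroup)

lemma integral_op_self:
  assumes "0 \<le> t" "bounded_borel f"
  shows "(\<integral>x. f x * op t f x \<partial>M) = (\<integral>x. (op (t / 2) f x)\<^sup>2 \<partial>M)"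
  using integral_op_add[of "t / 2" "t / 2" f] assms by (simp add: power2_eq_square)

text \<open>All three properties rest on (f, P_t f) being the squared L2 norm of P_{t/2} f:
  monotonicity is L2 contraction, and midpoint convexity is nonnegativity of the squared norm of
  P_{s/2} f - P_{t/2} f.\<close>

lemma decreasing_midpoint_convex_op:
  assumes f: "bounded_borel f"
  shows "decreasing_midpoint_convex (\<lambda>t. \<integral>x. f x * op t f x \<partial>M)"
proof
  fix s t :: real
  show "0 \<le> (\<integral>x. f x * op t f x \<partial>M)" if "0 \<le> t"
    using that f by (simp add: integral_op_self)
  show "(\<integral>x. f x * op t f x \<partial>M) \<le> (\<integral>x. f x * op s f x \<partial>M)" if "0 \<le> s" "s \<le> t"
  proof -
    have "op (t / 2) f x = op ((t - s) / 2) (op (s / 2) f) x" for x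
      using op_semigroup[of "(t - s) / 2" "s / 2" f x] that f by (simp flip: add_divide_distrib)
    then show ?thesis
      using that f integral_power2_op_le[of "(t - s) / 2" "op (s / 2) f"] by (simp add: integral_op_self)
  qed
  show "2 * (\<integral>x. f x * op ((s + t) / 2) f x \<partial>M)
      \<le> (\<integral>x. f x * op s f x \<partial>M) + (\<integral>x. f x * op t f x \<partial>M)" if "0 \<le> s" "0 \<le> t"
  proof -
    let ?a = "op (s / 2) f" and ?b = "op (t / 2) f"
    have "(\<integral>x. f x * op ((s + t) / 2) f x \<partial>M) = (\<integral>x. ?a x * ?b x \<partial>M)"
      using integral_op_add[of "s / 2" "t / 2" f] that f by (simp add: add_divide_distrib)
    moreover have "0 \<le> (\<integral>x. (?a x - ?b x)\<^sup>2 \<partial>M)" by simp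
    moreover have "(\<integral>x. (?a x - ?b x)\<^sup>2 \<partial>M)
        = (\<integral>x. (?a x)\<^sup>2 \<partial>M) + (\<integral>x. (?b x)\<^sup>2 \<partial>M) - 2 * (\<integral>x. ?a x * ?b x \<partial>M)"
      using that f by (simp add: power2_diff mult.assoc)
    ultimately show ?thesis using that f by (simp add: integral_op_self)
  qed
qed

end

section \<open>Total variation against the chi-square distance\<close>

text \<open>Write m for the total mass and q for \<open>V / (1 - V)\<close>. The extremal
  \<open>f\<close> equals q / m on a set of relative mass \<open>1 - V\<close> and -1 / m elsewhere.
  Accordingly the square of \<open>f\<close> is bounded below by its tangents at these two values,
  one on \<open>S\<close> and the other off \<open>S\<close>.\<close>

lemma tv_le_chi_square:
  fixes f :: "'b \<Rightarrow> real"
  assumes "finite_measure M"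
    and m: "0 < measure M (space M)" and f: "integrable M f" "integrable M (\<lambda>x. (f x)\<^sup>2)"
    and lower: "\<And>x. - 1 / measure M (space M) \<le> f x" and mean: "(\<integral>x. f x \<partial>M) = 0"
  defines "V \<equiv> (\<integral>x. \<bar>f x\<bar> \<partial>M) / 2" and "w \<equiv> measure M (space M) * (\<integral>x. (f x)\<^sup>2 \<partial>M)"
  assumes V: "1 / 2 \<le> V"
  shows "V * (1 + w) \<le> w"
proof -
  interpret finite_measure M by fact
  let ?m = "measure M (space M)"
  define S where "S = {x \<in> space M. 0 < f x}"
  have [measurable]: "f \<in> borel_measurable M" using f(1) by auto
  have S [measurable]: "S \<in> sets M" unfolding S_def by measurable
  define \<alpha> where "\<alpha> = measure M S / ?m"
  define p where "p = (\<lambda>x. (\<bar>f x\<bar> + f x) / 2)"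
  define n where "n = (\<lambda>x. (\<bar>f x\<bar> - f x) / 2)"
  have [simp]: "integrable M p" "integrable M n" using f(1) by (auto simp: p_def n_def)
  have p: "(\<integral>x. p x \<partial>M) = V" and n: "(\<integral>x. n x \<partial>M) = V"
    using f(1) mean by (simp_all add: p_def n_def V_def)
  have ind: "(\<integral>x. indicator S x \<partial>M) = \<alpha> * ?m" "(\<integral>x. indicator (space M - S) x \<partial>M) = (1 - \<alpha>) * ?m"
    using m by (simp_all add: \<alpha>_def finite_measure_compl field_simps)
  have [simp]: "integrable M (indicator A :: 'b \<Rightarrow> real)" if "A \<in> sets M" for A
    using that by (intro integrable_real_indicator) (simp_all add: less_top[symmetric])
  \<comment> \<open>The negative part is at most \<open>1 / ?m\<close> and vanishes on
    \<open>S\<close>; its integral \<open>V\<close> therefore limits the relative mass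
    \<open>\<alpha>\<close> of \<open>S\<close>.\<close>
  have "V \<le> (\<integral>x. 1 / ?m * indicator (space M - S) x \<partial>M)"
    unfolding n[symmetric]
  proof (rule integral_mono)
    fix x assume "x \<in> space M"
    then show "n x \<le> 1 / ?m * indicator (space M - S) x"
      using lower[of x] by (auto simp: n_def S_def indicator_def)
  qed simp_all
  also have "\<dots> = 1 - \<alpha>" using ind(2) m by simp
  finally have \<alpha>: "\<alpha> \<le> 1 - V" by simp
  \<comment> \<open>Otherwise \<open>S\<close> would be null, and with it the positive part, whose
    integral is \<open>V\<close>.\<close>
  have V1: "V < 1"
  proof (rule ccontr)
    assume "\<not> V < 1"
    then have "\<alpha> \<le> 0" using \<alpha> by simp
    then have "measure M S = 0" using m measure_nonneg[of M S] by (simp add: \<alpha>_def divide_le_0_iff)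
    then have "AE x in M. x \<notin> S"
      by (intro AE_not_in) (simp add: null_setsI emeasure_eq_measure)
    then have "AE x in M. p x = 0"
      by (rule AE_mp) (auto intro!: AE_I2 simp: S_def p_def)
    then have "V = 0" unfolding p[symmetric] by (rule integral_eq_zero_AE)
    then show False using V by simp
  qed
  define q where "q = V / (1 - V)"
  define a where "a = q / ?m"
  define b where "b = 1 / ?m"
  have q: "1 \<le> q" using V V1 by (simp add: q_def)
  have "(\<integral>x. 2 * a * p x - a\<^sup>2 * indicator S x + 2 * b * n x - b\<^sup>2 * indicator (space M - S) x \<partial>M)
      \<le> (\<integral>x. (f x)\<^sup>2 \<partial>M)"
  proof (rule integral_mono)
    fix x assume x: "x \<in> space M"
    have "0 \<le> (f x - a)\<^sup>2" "0 \<le> (f x + b)\<^sup>2" by simp_all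
    then show "2 * a * p x - a\<^sup>2 * indicator S x + 2 * b * n x - b\<^sup>2 * indicator (space M - S) x \<le> (f x)\<^sup>2"
      using x by (auto simp: S_def p_def n_def indicator_def power2_eq_square algebra_simps)
  qed (use f in auto)
  then have "2 * a * V - a\<^sup>2 * (\<alpha> * ?m) + 2 * b * V - b\<^sup>2 * ((1 - \<alpha>) * ?m) \<le> (\<integral>x. (f x)\<^sup>2 \<partial>M)"
    using p n ind by simp
  then have "?m * (2 * a * V - a\<^sup>2 * (\<alpha> * ?m) + 2 * b * V - b\<^sup>2 * ((1 - \<alpha>) * ?m)) \<le> w"
    unfolding w_def using m by (intro mult_left_mono) auto
  also have "?m * (2 * a * V - a\<^sup>2 * (\<alpha> * ?m) + 2 * b * V - b\<^sup>2 * ((1 - \<alpha>) * ?m))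
      = 2 * q * V + 2 * V - 1 - \<alpha> * (q\<^sup>2 - 1)"
    using m by (simp add: a_def b_def power2_eq_square field_simps)
  finally have w: "2 * q * V + 2 * V - 1 - \<alpha> * (q\<^sup>2 - 1) \<le> w" .
  \<comment> \<open>\<open>q \<ge> 1\<close>, a consequence of \<open>V \<ge> 1 / 2\<close>, gives
    the coefficient of \<open>\<alpha>\<close> the sign that permits replacing
    \<open>\<alpha>\<close> by \<open>1 - V\<close>.\<close>
  have "\<alpha> * (q\<^sup>2 - 1) \<le> (1 - V) * (q\<^sup>2 - 1)"
    using \<alpha> q by (intro mult_right_mono) (auto simp: power2_eq_square mult_ge1_I)
  also have "\<dots> = ((1 - V) * q) * q - 1 + V" by (simp add: power2_eq_square algebra_simps)
  also have "(1 - V) * q = V" using V1 by (simp add: q_def)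
  finally have "q * V + V \<le> w" using w by (simp add: mult.commute)
  also have "q * V + V = V / (1 - V)" using V1 by (simp add: q_def field_simps)
  finally show ?thesis using V1 by (simp add: field_simps)
qed

section \<open>From the process to its transition kernels\<close>

context continuous_strong_markov_process
begin

lemma measurable_B: "0 \<le> t \<Longrightarrow> B t \<in> P x \<rightarrow>\<^sub>M borel"
  using measurable_mono[of borel borel "F (ennreal t)" "P x"] adapted[of t] sets_F[of "ennreal t" x]
  by (auto simp: space_F space_P)

text \<open>The strong Markov property is applied at the deterministic stopping time
  \<open>s\<close>, and the expectation of the conditional expectation is taken.\<close>

lemma chapman_kolmogorov:
  assumes s: "0 \<le> s" and t: "0 \<le> t" and A [measurable]: "A \<in> sets borel"
  shows "measure (distr (P x) borel (B (s + t))) A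
    = (\<integral>y. measure (distr (P y) borel (B t)) A \<partial>distr (P x) borel (B s))"
proof -
  interpret prob_space "P x" by (rule prob_space_P)
  have [measurable]: "B t \<in> P x \<rightarrow>\<^sub>M borel" "B s \<in> P x \<rightarrow>\<^sub>M borel" "B (s + t) \<in> P x \<rightarrow>\<^sub>M borel" for x
    using s t by (auto intro: measurable_B)
  let ?\<sigma> = "\<lambda>\<omega>::'w. ennreal s"
  let ?G = "pre_sigma ?\<sigma>"
  have \<sigma>: "stopping_time F ?\<sigma>" by (rule stopping_time_const)
  have "subalgebra (P x) ?G"
    unfolding subalgebra_def space_pre_sigma space_P
  proof (intro conjI subsetI)
    fix C assume "C \<in> sets ?G"
    then have "C \<in> sets (F \<infinity>)" using sets_pre_sigmaD[OF \<sigma>, of C \<infinity>] by simp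
    then show "C \<in> sets (P x)" using sets_F by blast
  qed simp
  then interpret finite_measure_subalgebra "P x" ?G
    by unfold_locales
  define I where "I = (indicator {\<omega>\<in>\<Omega>. B (s + t) \<omega> \<in> A} :: 'w \<Rightarrow> real)"
  have E: "{\<omega>\<in>\<Omega>. B r \<omega> \<in> A} = B r -` A \<inter> space (P y)" for r y by (auto simp: space_P)
  have meas: "measure (P y) {\<omega>\<in>\<Omega>. B r \<omega> \<in> A} = measure (distr (P y) borel (B r)) A" if "0 \<le> r" for r y
    unfolding E[of r y] using that by (intro measure_distr[symmetric] measurable_B) auto
  have set: "{\<omega>\<in>\<Omega>. B (s + t) \<omega> \<in> A} \<in> sets (P x)"
    unfolding E[of "s + t" x] by measurable
  have I: "integrable (P x) I" unfolding I_def using set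
    by (intro integrable_real_indicator) (simp_all add: less_top[symmetric])
  have km: "(\<lambda>y. measure (distr (P y) borel (B t)) A) \<in> borel_measurable borel"
    by (rule measurable_compose[OF measurable_prob_algebraD[OF kernel[OF t]] measurable_measure_subprob_algebra[OF A]])
  have "AE \<omega> in P x. real_cond_exp (P x) ?G I \<omega> = measure (P (B s \<omega>)) {\<omega>'\<in>\<Omega>. B t \<omega>' \<in> A}"
    using strong_markov[OF \<sigma> t A, of x] s by (simp add: I_def)
  then have AE: "AE \<omega> in P x. real_cond_exp (P x) ?G I \<omega> = measure (distr (P (B s \<omega>)) borel (B t)) A"
    by (simp add: meas t)
  have "measure (distr (P x) borel (B (s + t))) A = (\<integral>\<omega>. I \<omega> \<partial>P x)"
    unfolding I_def using set s t by (simp add: meas[symmetric])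
  also have "\<dots> = (\<integral>\<omega>. real_cond_exp (P x) ?G I \<omega> \<partial>P x)"
    using real_cond_exp_int(2)[OF I] by simp
  also have "\<dots> = (\<integral>\<omega>. measure (distr (P (B s \<omega>)) borel (B t)) A \<partial>P x)"
    using AE measurable_compose[OF \<open>\<And>x. B s \<in> P x \<rightarrow>\<^sub>M borel\<close> km] by (intro integral_cong_AE) auto
  also have "\<dots> = (\<integral>y. measure (distr (P y) borel (B t)) A \<partial>distr (P x) borel (B s))"
    using km by (intro integral_distr[symmetric]) auto
  finally show ?thesis .
qed

lemma transition_operator_eq:
  assumes "0 \<le> t" "f \<in> borel_measurable borel"
  shows "transition_operator P B t f x = (\<integral>y. f y \<partial>distr (P x) borel (B t))"
  using assms measurable_B[of t x] unfolding transition_operator_def by (intro integral_distr[symmetric]) auto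

end

lemma (in nu_brownian_motion) symmetric_markov_kernels:
  assumes "finite_measure \<nu>" "sets \<nu> = sets borel"
  shows "symmetric_markov_kernels \<nu> (\<lambda>t x. distr (P x) borel (B t))"
proof -
  interpret finite_measure \<nu> by fact
  show ?thesis
  proof
    fix t :: real and f g :: "'a \<Rightarrow> ennreal"
    assume t: "0 \<le> t" and [measurable]: "f \<in> borel_measurable borel" "g \<in> borel_measurable borel"
    have [measurable]: "B t \<in> P x \<rightarrow>\<^sub>M borel" for x using t by (rule measurable_B)
    show "(\<integral>\<^sup>+x. f x * (\<integral>\<^sup>+y. g y \<partial>distr (P x) borel (B t)) \<partial>\<nu>)
        = (\<integral>\<^sup>+x. (\<integral>\<^sup>+y. f y \<partial>distr (P x) borel (B t)) * g x \<partial>\<nu>)"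
      using symmetric[OF t, of f g] by (simp add: nn_integral_distr)
  qed (use assms kernel chapman_kolmogorov in auto)
qed

section \<open>Convergence to equilibrium\<close>

locale compact_tree_brownian_motion = real_tree "TYPE('a)" + nu_brownian_motion \<Omega> F P B \<rho> \<nu>
  for \<Omega> :: "'w set" and F :: "ennreal \<Rightarrow> 'w measure"
    and P :: "'a::metric_space \<Rightarrow> 'w measure" and B :: "real \<Rightarrow> 'w \<Rightarrow> 'a"
    and \<rho> :: 'a and \<nu> :: "'a measure" +
  assumes compact: "compact (UNIV :: 'a set)" and radon: "radon_full_support \<nu>"
begin

lemma sets_\<nu>: "sets \<nu> = sets borel"
  using radon by (simp add: radon_full_support_def)

lemma finite_\<nu>: "finite_measure \<nu>"
  using radon compact sets_eq_imp_space_eq[OF sets_\<nu>]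
  by (intro finite_measureI) (auto simp: radon_full_support_def)

sublocale S: symmetric_markov_kernels \<nu> "\<lambda>t x. distr (P x) borel (B t)"
  by (rule symmetric_markov_kernels[OF finite_\<nu> sets_\<nu>])

lemma mass_pos: "0 < measure \<nu> UNIV"
proof -
  \<comment> \<open>Every ball has positive mass; \<open>undefined\<close> is just some point of the
    tree.\<close>
  have "0 < emeasure \<nu> (ball undefined 1)" using radon by (simp add: radon_full_support_def)
  also have "\<dots> \<le> emeasure \<nu> UNIV" by (intro emeasure_mono) (auto simp: sets_\<nu>)
  finally show ?thesis by (simp add: S.emeasure_eq_measure)
qed

lemma diameter_nonneg: "0 \<le> diameter (UNIV :: 'a set)"
  by (intro diameter_ge_0 compact_imp_bounded compact)

lemma integral_abs_power2_le:
  assumes "S.bounded_borel f"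
  shows "(\<integral>x. \<bar>f x\<bar> \<partial>\<nu>)\<^sup>2 \<le> measure \<nu> UNIV * (\<integral>x. (f x)\<^sup>2 \<partial>\<nu>)"
proof -
  have "(LINT x:UNIV|\<nu>. \<bar>f x\<bar>)\<^sup>2 \<le> measure \<nu> UNIV * (LINT x:UNIV|\<nu>. \<bar>f x\<bar>\<^sup>2)"
    using assms by (intro set_integral_power2_le) (auto simp: sets_\<nu> set_integrable_def S.emeasure_eq_measure)
  then show ?thesis by (simp add: set_lebesgue_integral_def)
qed

lemma form_domain_bounded_borel:
  assumes "f \<in> form_domain \<rho> \<nu>" shows "continuous_on UNIV f" "S.bounded_borel f"
proof -
  show f: "continuous_on UNIV f"
    using assms by (simp add: form_domain_def finite_energy_def loc_abs_continuous_def)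
  then have "bounded (range f)" by (intro compact_imp_bounded compact_continuous_image compact)
  then show "S.bounded_borel f"
    using borel_measurable_continuous_onI[OF f] by (auto simp: S.bounded_borel_def bounded_real)
qed

text \<open>Since \<open>f\<close> has mean zero it may be multiplied by \<open>f - a\<close> instead of \<open>f\<close>, where \<open>a\<close> is the centre
  of its range.\<close>

lemma integral_power2_le_energy_form:
  assumes f: "f \<in> form_domain \<rho> \<nu>" and mean: "(\<integral>x. f x \<partial>\<nu>) = 0"
  shows "(\<integral>x. (f x)\<^sup>2 \<partial>\<nu>)\<^sup>2
    \<le> ((\<integral>x. \<bar>f x\<bar> \<partial>\<nu>) / 2)\<^sup>2 * (2 * diameter (UNIV :: 'a set) * energy_form \<rho> f f)"
proof -
  note bb [simp] = form_domain_bounded_borel(2)[OF f]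
  obtain p where p: "\<And>x. f x \<le> f p"
    using continuous_attains_sup[OF compact _ form_domain_bounded_borel(1)[OF f]] by auto
  obtain q where q: "\<And>x. f q \<le> f x"
    using continuous_attains_inf[OF compact _ form_domain_bounded_borel(1)[OF f]] by auto
  define a where "a = (f p + f q) / 2"
  have "(\<integral>x. (f x)\<^sup>2 \<partial>\<nu>) = (\<integral>x. f x * (f x - a) \<partial>\<nu>)"
    using mean by (simp add: right_diff_distrib power2_eq_square)
  also have "\<dots> \<le> (\<integral>x. \<bar>f x\<bar> * ((f p - f q) / 2) \<partial>\<nu>)"
  proof (rule integral_mono)
    fix x
    have "\<bar>f x - a\<bar> \<le> (f p - f q) / 2"
      using p[of x] q[of x] unfolding a_def by (auto simp: abs_if field_simps)
    then have "\<bar>f x\<bar> * \<bar>f x - a\<bar> \<le> \<bar>f x\<bar> * ((f p - f q) / 2)" by (intro mult_left_mono) auto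
    then show "f x * (f x - a) \<le> \<bar>f x\<bar> * ((f p - f q) / 2)"
      using abs_ge_self[of "f x * (f x - a)"] unfolding abs_mult by linarith
  qed auto
  also have "\<dots> = (\<integral>x. \<bar>f x\<bar> \<partial>\<nu>) / 2 * (f p - f q)" by simp
  finally have "(\<integral>x. (f x)\<^sup>2 \<partial>\<nu>)\<^sup>2 \<le> ((\<integral>x. \<bar>f x\<bar> \<partial>\<nu>) / 2 * (f p - f q))\<^sup>2"
    by (intro power_mono) auto
  also have "\<dots> = ((\<integral>x. \<bar>f x\<bar> \<partial>\<nu>) / 2)\<^sup>2 * (f p - f q)\<^sup>2" by (rule power_mult_distrib)
  also have "\<dots> \<le> ((\<integral>x. \<bar>f x\<bar> \<partial>\<nu>) / 2)\<^sup>2 * (2 * diameter (UNIV :: 'a set) * energy_form \<rho> f f)"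
    using energy_form_oscillation[OF compact f] by (intro mult_left_mono) auto
  finally show ?thesis .
qed

text \<open>Convexity of \<open>t \<mapsto> (f, P\<^sub>t f)\<close> makes the difference quotients converge, so the semigroup maps
  into the form domain.\<close>

lemma op_in_form_domain:
  assumes f: "S.bounded_borel f" and c: "0 < c"
  defines "\<phi> \<equiv> \<lambda>t. \<integral>x. f x * S.op t f x \<partial>\<nu>"
  shows "\<exists>g\<in>form_domain \<rho> \<nu>. (AE x in \<nu>. S.op (c / 2) f x = g x) \<and>
    energy_form \<rho> g g = decreasing_midpoint_convex.decay \<phi> c"
proof -
  interpret D: decreasing_midpoint_convex \<phi>
    unfolding \<phi>_def by (rule S.decreasing_midpoint_convex_op[OF f])
  define u where "u = S.op (c / 2) f"
  have u [simp]: "S.bounded_borel u" using f c by (simp add: u_def)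
  have T: "transition_operator P B r v x = S.op r v x" if "0 \<le> r" "S.bounded_borel v" for r v x
    using that by (simp add: transition_operator_eq S.op_def S.bounded_borelD)
  \<comment> \<open>The semigroup law turns the approximating form at \<open>u\<close> into a
    difference quotient of \<open>\<phi>\<close> at \<open>c\<close>, whose limit is the
    decay.\<close>
  have quot: "approximating_form \<nu> (transition_operator P B) r u u = (\<phi> c - \<phi> (c + r)) / r" if r: "0 < r" for r
  proof -
    have "(\<integral>x. u x * u x \<partial>\<nu>) = \<phi> c"
      using S.integral_op_add[of "c / 2" "c / 2" f] f c by (simp add: u_def \<phi>_def)
    moreover have "S.op r u x = S.op (c / 2 + r) f x" for x
      using S.op_semigroup[of r "c / 2" f x] f c r by (simp add: u_def add.commute)
    then have "(\<integral>x. S.op r u x * u x \<partial>\<nu>) = \<phi> (c + r)"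
      using S.integral_op_add[of "c / 2 + r" "c / 2" f] f c r by (simp add: u_def \<phi>_def add.commute add.left_commute)
    ultimately show ?thesis
      using r by (simp add: approximating_form_def T left_diff_distrib)
  qed
  have lim: "((\<lambda>r. approximating_form \<nu> (transition_operator P B) r u u) \<longlongrightarrow> D.decay c) (at_right 0)"
    by (rule tendsto_cong[THEN iffD2, OF _ D.decay_tendsto[OF c]])
      (auto simp: eventually_at_right_field quot intro!: exI[of _ 1])
  have "square_integrable \<nu> u"
    using borel_measurable_integrable[OF S.integrable_bounded_borel[OF u]] by (simp add: square_integrable_def)
  then obtain g where g: "g \<in> form_domain \<rho> \<nu>" and AE: "AE x in \<nu>. u x = g x"
    using associated lim unfolding associated_with_form_def by blast
  note [simp] = form_domain_bounded_borel(2)[OF g]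
  \<comment> \<open>The energy is defined at the representative \<open>g\<close> in the domain,
    while the limit is known at \<open>u\<close>; a change on a null set does not affect the
    approximating form.\<close>
  have "approximating_form \<nu> (transition_operator P B) r g g = approximating_form \<nu> (transition_operator P B) r u u"
    if r: "0 < r" for r
  proof -
    have "AE x in \<nu>. (g x - S.op r g x) * g x = (u x - S.op r u x) * u x"
      using AE S.op_cong_AE[OF less_imp_le[OF r] u form_domain_bounded_borel(2)[OF g] AE] by eventually_elim simp
    then have "(\<integral>x. (g x - S.op r g x) * g x \<partial>\<nu>) = (\<integral>x. (u x - S.op r u x) * u x \<partial>\<nu>)"
      using r by (intro integral_cong_AE) (auto intro!: borel_measurable_integrable)
    then show ?thesis using r by (simp add: approximating_form_def T)
  qed
  then have "((\<lambda>r. approximating_form \<nu> (transition_operator P B) r g g) \<longlongrightarrow> D.decay c) (at_right 0)"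
    by (intro tendsto_cong[THEN iffD2, OF _ lim]) (auto simp: eventually_at_right_field intro!: exI[of _ 1])
  moreover have "((\<lambda>r. approximating_form \<nu> (transition_operator P B) r g g) \<longlongrightarrow> energy_form \<rho> g g) (at_right 0)"
    using associated g unfolding associated_with_form_def by blast
  ultimately have "energy_form \<rho> g g = D.decay c" by (intro tendsto_unique) auto
  with g AE show ?thesis by (auto simp: u_def)
qed

text \<open>Both decay hypotheses of \<open>total_variation_decay\<close> come from
  \<open>integral_power2_le_energy_form\<close>: estimating the L1 norm by 2 gives the quadratic
  one, estimating it by Cauchy-Schwarz gives the linear one.\<close>

lemma density_decay:
  assumes h: "S.bounded_borel h" "\<And>x. 0 \<le> h x" "(\<integral>x. h x \<partial>\<nu>) = 1" and t: "0 \<le> t"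
  shows "(\<integral>x. \<bar>S.op t h x - 1 / measure \<nu> UNIV\<bar> \<partial>\<nu>) / 2
    \<le> exp (- t / (2 * diameter (UNIV :: 'a set) * measure \<nu> UNIV))"
proof -
  let ?m = "measure \<nu> UNIV" and ?D = "diameter (UNIV :: 'a set)"
  note m = mass_pos
  define f where "f x = h x - 1 / ?m" for x
  have f [simp]: "S.bounded_borel f" unfolding f_def using h(1) by simp
  have mean: "(\<integral>x. f x \<partial>\<nu>) = 0" using h m by (simp add: f_def)
  have mean_op: "(\<integral>x. S.op s f x \<partial>\<nu>) = 0" if "0 \<le> s" for s
    using mean that by (simp add: S.integral_op)
  have "(\<integral>x. \<bar>f x\<bar> \<partial>\<nu>) \<le> (\<integral>x. h x + 1 / ?m \<partial>\<nu>)"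
  proof (rule integral_mono)
    fix x show "\<bar>f x\<bar> \<le> h x + 1 / ?m" using h(2)[of x] m by (simp add: f_def abs_if)
  qed (use h in simp_all)
  also have "\<dots> = 2" using h m by simp
  finally have L1: "(\<integral>x. \<bar>S.op s f x\<bar> \<partial>\<nu>) / 2 \<le> 1" if "0 \<le> s" for s
    using S.integral_abs_op_le[OF that f] by simp
  define \<phi> where "\<phi> t = (\<integral>x. f x * S.op t f x \<partial>\<nu>)" for t
  interpret D: decreasing_midpoint_convex \<phi>
    unfolding \<phi>_def by (rule S.decreasing_midpoint_convex_op[OF f])
  have \<phi>: "\<phi> c = (\<integral>x. (S.op (c / 2) f x)\<^sup>2 \<partial>\<nu>)" if "0 \<le> c" for c
    using that by (simp add: \<phi>_def S.integral_op_self)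
  have energy: "(\<phi> c)\<^sup>2 \<le> ((\<integral>x. \<bar>S.op (c / 2) f x\<bar> \<partial>\<nu>) / 2)\<^sup>2 * (2 * ?D * D.decay c)" if c: "0 < c" for c
  proof -
    obtain g where g: "g \<in> form_domain \<rho> \<nu>" "AE x in \<nu>. S.op (c / 2) f x = g x"
        "energy_form \<rho> g g = D.decay c"
      using op_in_form_domain[OF f c] unfolding \<phi>_def by blast
    have [measurable]: "S.op (c / 2) f \<in> borel_measurable \<nu>" "g \<in> borel_measurable \<nu>"
      using c form_domain_bounded_borel(2)[OF g(1)] by (auto intro!: borel_measurable_integrable)
    have "(\<integral>x. g x \<partial>\<nu>) = (\<integral>x. S.op (c / 2) f x \<partial>\<nu>)"
      "(\<integral>x. \<bar>g x\<bar> \<partial>\<nu>) = (\<integral>x. \<bar>S.op (c / 2) f x\<bar> \<partial>\<nu>)"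
      "(\<integral>x. (g x)\<^sup>2 \<partial>\<nu>) = (\<integral>x. (S.op (c / 2) f x)\<^sup>2 \<partial>\<nu>)"
      using g(2) by (intro integral_cong_AE; auto)+
    then show ?thesis
      using integral_power2_le_energy_form[OF g(1)] g(3) mean_op[of "c / 2"] c by (simp add: \<phi>)
  qed
  have quad: "(\<phi> c)\<^sup>2 \<le> 2 * ?D * D.decay c" if c: "0 < c" for c
  proof -
    let ?v = "(\<integral>x. \<bar>S.op (c / 2) f x\<bar> \<partial>\<nu>) / 2"
    have "?v\<^sup>2 \<le> 1" using L1[of "c / 2"] c by (simp add: power_le_one)
    then have "?v\<^sup>2 * (2 * ?D * D.decay c) \<le> 1 * (2 * ?D * D.decay c)"
      using D.decay_nonneg[OF c] diameter_nonneg by (intro mult_right_mono) auto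
    then show ?thesis using energy[OF c] by simp
  qed
  have lin: "\<phi> c \<le> ?m * ?D / 2 * D.decay c" if c: "0 < c" for c
  proof -
    have decay: "0 \<le> D.decay c" using c by (rule D.decay_nonneg)
    let ?v = "(\<integral>x. \<bar>S.op (c / 2) f x\<bar> \<partial>\<nu>) / 2"
    have "?v\<^sup>2 \<le> ?m * \<phi> c / 4"
      using integral_abs_power2_le[of "S.op (c / 2) f"] c by (simp add: \<phi> power_divide)
    then have "?v\<^sup>2 * (2 * ?D * D.decay c) \<le> ?m * \<phi> c / 4 * (2 * ?D * D.decay c)"
      using decay diameter_nonneg by (intro mult_right_mono) auto
    with energy[OF c] have "(\<phi> c)\<^sup>2 \<le> ?m * \<phi> c / 4 * (2 * ?D * D.decay c)" by (rule order_trans)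
    \<comment> \<open>One factor \<open>\<phi> c\<close> cancels; where it is 0 the bound is
      trivial.\<close>
    then have "\<phi> c * \<phi> c \<le> \<phi> c * (?m * ?D / 2 * D.decay c)"
      by (simp add: power2_eq_square mult_ac)
    moreover have "0 \<le> ?m * ?D / 2 * D.decay c" using decay diameter_nonneg m by simp
    ultimately show ?thesis using D.nonneg[of c] c by (cases "\<phi> c = 0") auto
  qed
  define V where "V = (\<integral>x. \<bar>S.op t f x\<bar> \<partial>\<nu>) / 2"
  have "V \<le> exp (- t / (2 * ?D * ?m))"
  proof (rule D.total_variation_decay[OF m diameter_nonneg t quad lin])
    show "0 \<le> V" by (simp add: V_def)
    show "V \<le> 1" using L1[OF t] by (simp add: V_def)
    show "V\<^sup>2 \<le> ?m * \<phi> (2 * t) / 4"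
      using integral_abs_power2_le[of "S.op t f"] t by (simp add: V_def \<phi> power_divide)
    \<comment> \<open>Positivity of the kernels preserves the lower bound of
      \<open>f\<close>.\<close>
    have "- 1 / ?m \<le> S.op t f x" for x
      using S.op_mono[of t "\<lambda>_. - 1 / ?m" f x] t h(2) by (simp add: f_def)
    then show "V * (1 + ?m * \<phi> (2 * t)) \<le> ?m * \<phi> (2 * t)" if "1 / 2 \<le> V"
      using tv_le_chi_square[OF finite_\<nu>, of "S.op t f"] that mean_op[OF t] m t by (simp add: V_def \<phi>)
  qed
  moreover have "S.op t f x = S.op t h x - 1 / ?m" for x
    unfolding f_def using S.op_diff[of t h "\<lambda>_. 1 / ?m"] t h(1) by simp
  ultimately show ?thesis by (simp add: V_def)
qed

text \<open>The dual form of \<open>density_decay\<close>, with the semigroup moved onto the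
  indicator. Homogeneity in \<open>h\<close> admits any total mass, in particular that of a
  truncated density.\<close>

lemma expectation_decay:
  assumes h: "S.bounded_borel h" "\<And>x. 0 \<le> h x" and t: "0 \<le> t" and A: "A \<in> sets borel"
  shows "\<bar>\<integral>x. h x * (S.op t (indicator A) x - measure \<nu> A / measure \<nu> UNIV) \<partial>\<nu>\<bar>
    \<le> exp (- t / (2 * diameter (UNIV :: 'a set) * measure \<nu> UNIV)) * (\<integral>x. h x \<partial>\<nu>)"
proof (cases "(\<integral>x. h x \<partial>\<nu>) = 0")
  case True
  then have "AE x in \<nu>. h x = 0" using h by (subst (asm) integral_nonneg_eq_0_iff_AE) auto
  then have "(\<integral>x. h x * (S.op t (indicator A) x - measure \<nu> A / measure \<nu> UNIV) \<partial>\<nu>) = 0"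
    by (intro integral_eq_zero_AE) auto
  then show ?thesis using True by simp
next
  case False
  let ?m = "measure \<nu> UNIV" and ?e = "exp (- t / (2 * diameter (UNIV :: 'a set) * measure \<nu> UNIV))"
  define c where "c = (\<integral>x. h x \<partial>\<nu>)"
  have "0 \<le> c" unfolding c_def using h(2) by simp
  then have c: "0 < c" using False by (simp add: c_def)
  define h' where "h' = (\<lambda>x. 1 / c * h x)"
  have h': "S.bounded_borel h'" "\<And>x. 0 \<le> h' x" "(\<integral>x. h' x \<partial>\<nu>) = 1"
    using h c S.bounded_borel_mult[of "\<lambda>_. 1 / c" h] by (simp_all add: h'_def c_def)
  define v where "v x = S.op t h' x - 1 / ?m" for x
  have v: "S.bounded_borel v" using h' t by (simp add: v_def[abs_def])
  have "(\<integral>x. v x \<partial>\<nu>) = 0" using h' t mass_pos by (simp add: v_def S.integral_op)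
  moreover have A': "S.bounded_borel (indicator A)" using A by simp
  moreover have "(\<integral>x. h' x * (S.op t (indicator A) x - measure \<nu> A / ?m) \<partial>\<nu>)
      = (\<integral>x. S.op t h' x * indicator A x \<partial>\<nu>) - measure \<nu> A / ?m"
    using h' t A' S.integral_op_symmetric[of t h' "indicator A"] by (simp add: right_diff_distrib)
  \<comment> \<open>As \<open>v\<close> has mean zero, 1/2 may be subtracted from the indicator; the
    difference has absolute value 1/2, which matches the factor 1/2 in
    \<open>density_decay\<close>.\<close>
  ultimately have "(\<integral>x. h' x * (S.op t (indicator A) x - measure \<nu> A / ?m) \<partial>\<nu>)
      = (\<integral>x. v x * (indicator A x - 1 / 2) \<partial>\<nu>)"
    using h' t v A by (simp add: v_def right_diff_distrib left_diff_distrib sets_\<nu>)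
  also have "\<bar>\<dots>\<bar> \<le> (\<integral>x. \<bar>v x * (indicator A x - 1 / 2)\<bar> \<partial>\<nu>)" by (rule integral_abs_bound)
  also have "\<dots> = (\<integral>x. \<bar>v x\<bar> / 2 \<partial>\<nu>)"
    by (intro Bochner_Integration.integral_cong refl) (auto simp: indicator_def abs_mult)
  also have "\<dots> \<le> ?e"
    using density_decay[OF h' t] by (simp add: v_def)
  finally have "\<bar>\<integral>x. h' x * (S.op t (indicator A) x - measure \<nu> A / ?m) \<partial>\<nu>\<bar> \<le> ?e" .
  then have "\<bar>(\<integral>x. h x * (S.op t (indicator A) x - measure \<nu> A / ?m) \<partial>\<nu>) / c\<bar> \<le> ?e"
    by (simp add: h'_def)
  then show ?thesis using c by (simp add: c_def[symmetric] abs_divide field_simps)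
qed

text \<open>The rate in \<open>expectation_decay\<close> does not depend on the size of the density.
  The bound therefore passes from the truncations \<open>min (h x) (real n)\<close> to the
  Radon-Nikodym density \<open>h\<close> by dominated convergence, with majorant
  \<open>C * h x\<close>.\<close>

lemma law_at_decay:
  assumes \<nu>': "prob_space \<nu>'" "sets \<nu>' = sets borel" "absolutely_continuous \<nu> \<nu>'"
    and t: "0 \<le> t" and A: "A \<in> sets borel"
  shows "\<bar>measure (law_at P B t \<nu>') A - inverse (measure \<nu> UNIV) * measure \<nu> A\<bar>
    \<le> exp (- t / (2 * diameter (UNIV :: 'a set) * measure \<nu> UNIV))"
proof -
  let ?e = "exp (- t / (2 * diameter (UNIV :: 'a set) * measure \<nu> UNIV))"
  interpret N: prob_space \<nu>' by fact
  have [measurable_cong]: "sets \<nu>' = sets borel" by fact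
  define q where "q x = S.op t (indicator A) x - measure \<nu> A / measure \<nu> UNIV" for x
  have A' [simp]: "S.bounded_borel (indicator A)" using A by simp
  have q: "S.bounded_borel q" unfolding q_def using t by simp
  then have [measurable]: "q \<in> borel_measurable borel" by (rule S.bounded_borelD)
  obtain C where C: "0 \<le> C" "\<And>x. \<bar>q x\<bar> \<le> C" using S.bounded_borel_bound[OF q] by blast
  obtain h where h [measurable]: "h \<in> borel_measurable \<nu>" and RN: "AE x in \<nu>. RN_deriv \<nu> \<nu>' x = ennreal (h x)"
      and h0: "\<And>x. 0 \<le> h x"
    using S.real_RN_deriv[OF N.finite_measure_axioms \<nu>'(3)] \<nu>'(2) sets_\<nu> by metis
  have \<nu>'_eq: "\<nu>' = density \<nu> (\<lambda>x. ennreal (h x))"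
    using S.density_RN_deriv[OF \<nu>'(3)] \<nu>'(2) density_cong[OF _ _ RN] by (simp add: sets_\<nu>)
  have "(\<integral>\<^sup>+x. ennreal (h x) \<partial>\<nu>) = 1"
    using N.emeasure_space_1 by (simp add: \<nu>'_eq emeasure_density)
  then have int_h: "integrable \<nu> h" and h1: "(\<integral>x. h x \<partial>\<nu>) = 1"
    using h0 by (auto intro!: integrableI_nonneg simp: integral_eq_nn_integral)
  have int_q: "integrable \<nu>' q"
    using C by (intro N.integrable_const_bound[where B = C]) auto
  have int_op: "integrable \<nu>' (S.op t (indicator A))"
    using Bochner_Integration.integrable_add[OF int_q, of "\<lambda>_. measure \<nu> A / measure \<nu> UNIV"]
    by (simp add: q_def)
  have op_ind: "S.op t (indicator A) x = measure (distr (P x) borel (B t)) A" for x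
    using A by (simp add: S.op_def)
  have "emeasure (law_at P B t \<nu>') A = (\<integral>\<^sup>+x. emeasure (distr (P x) borel (B t)) A \<partial>\<nu>')"
    unfolding law_at_def using S.kernel_subprob[OF t] A N.not_empty
    by (intro emeasure_bind) (auto cong: measurable_cong_sets)
  also have "\<dots> = (\<integral>\<^sup>+x. ennreal (S.op t (indicator A) x) \<partial>\<nu>')"
    by (simp add: op_ind finite_measure.emeasure_eq_measure[OF prob_space.finite_measure[OF S.kernel_space(1)[OF t]]])
  also have "\<dots> = ennreal (\<integral>x. S.op t (indicator A) x \<partial>\<nu>')"
    by (intro nn_integral_eq_integral int_op) (simp add: op_ind)
  finally have "measure (law_at P B t \<nu>') A = (\<integral>x. S.op t (indicator A) x \<partial>\<nu>')"
    by (simp add: measure_def op_ind integral_nonneg_AE)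
  also have "\<dots> = (\<integral>x. q x + measure \<nu> A / measure \<nu> UNIV \<partial>\<nu>')" by (simp add: q_def)
  also have "\<dots> = (\<integral>x. q x \<partial>\<nu>') + inverse (measure \<nu> UNIV) * measure \<nu> A"
    using int_q N.prob_space by (simp add: divide_inverse mult.commute)
  \<comment> \<open>The error at \<open>A\<close> is the pairing of the density with the centred
    transition probability \<open>q\<close>.\<close>
  finally have eq: "measure (law_at P B t \<nu>') A - inverse (measure \<nu> UNIV) * measure \<nu> A = (\<integral>x. h x * q x \<partial>\<nu>)"
    using h0 by (simp add: \<nu>'_eq integral_density)
  define hn where "hn n x = min (h x) (real n)" for n x
  have h_borel: "h \<in> borel_measurable borel" using h by (simp add: sets_\<nu> cong: measurable_cong_sets)
  have hn: "S.bounded_borel (hn n)" "0 \<le> hn n x" "hn n x \<le> h x" for n x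
    using h_borel h0 by (auto simp: S.bounded_borel_def hn_def[abs_def] intro!: exI[of _ "real n"])
  have "\<bar>\<integral>x. hn n x * q x \<partial>\<nu>\<bar> \<le> ?e" for n
  proof -
    have "\<bar>\<integral>x. hn n x * q x \<partial>\<nu>\<bar> \<le> ?e * (\<integral>x. hn n x \<partial>\<nu>)"
      unfolding q_def using hn t A by (intro expectation_decay)
    also have "\<dots> \<le> ?e * (\<integral>x. h x \<partial>\<nu>)"
      using hn int_h by (intro mult_left_mono integral_mono) auto
    finally show ?thesis using h1 by simp
  qed
  moreover have "(\<lambda>n. \<bar>\<integral>x. hn n x * q x \<partial>\<nu>\<bar>) \<longlonglongrightarrow> \<bar>\<integral>x. h x * q x \<partial>\<nu>\<bar>"
  proof (intro tendsto_rabs integral_dominated_convergence)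
    show "integrable \<nu> (\<lambda>x. C * h x)" using int_h by simp
    have "(\<lambda>n. hn n x) \<longlonglongrightarrow> h x" for x
    proof (rule tendsto_eventually)
      show "\<forall>\<^sub>F n in sequentially. hn n x = h x"
        using eventually_ge_at_top[of "nat \<lceil>h x\<rceil>"] by eventually_elim (auto simp: hn_def min_def)
    qed
    then show "AE x in \<nu>. (\<lambda>n. hn n x * q x) \<longlonglongrightarrow> h x * q x" by (auto intro!: tendsto_intros)
    show "AE x in \<nu>. norm (hn n x * q x) \<le> C * h x" for n
      using mult_mono[OF hn(3) C(2)] hn(2) h0 C(1) by (auto simp: abs_mult mult.commute)
    have [measurable]: "hn n \<in> borel_measurable borel" for n using hn(1) by (rule S.bounded_borelD)
    show "(\<lambda>x. h x * q x) \<in> borel_measurable \<nu>" by measurable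
    show "(\<lambda>x. hn n x * q x) \<in> borel_measurable \<nu>" for n by measurable
  qed
  ultimately show ?thesis unfolding eq by (intro LIMSEQ_le_const2) auto
qed

end

theorem theorem3:
  fixes \<rho> :: "'a::metric_space"
    and \<nu> \<nu>' :: "'a measure"
    and \<Omega> :: "'w set" and F :: "ennreal \<Rightarrow> 'w measure"
    and P :: "'a \<Rightarrow> 'w measure" and B :: "real \<Rightarrow> 'w \<Rightarrow> 'a"
    and t :: real
  assumes "R_tree TYPE('a)"
    and "compact (UNIV :: 'a set)"
    and "radon_full_support \<nu>"
    and "nu_brownian_motion \<Omega> F P B \<rho> \<nu>"
    and "prob_space \<nu>'" and "sets \<nu>' = sets borel"
    and "absolutely_continuous \<nu> \<nu>'"
    and "integrable \<nu>' (\<lambda>x. enn2real (RN_deriv \<nu> \<nu>' x))"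
    and "0 \<le> t"
  shows "tv_norm (\<lambda>A. measure (law_at P B t \<nu>') A - inverse (measure \<nu> UNIV) * measure \<nu> A)
    \<le> (1 + measure \<nu> UNIV * sqrt (\<integral>x. enn2real (RN_deriv \<nu> \<nu>' x) \<partial>\<nu>'))
       * exp (- t / (2 * diameter (UNIV :: 'a set) * measure \<nu> UNIV))"
proof -
  interpret nu_brownian_motion \<Omega> F P B \<rho> \<nu> by fact
  interpret compact_tree_brownian_motion \<Omega> F P B \<rho> \<nu>
    using assms(1-3) by unfold_locales
  \<comment> \<open>\<open>law_at_decay\<close> is uniform in the event and so bounds the supremum;
    the prefactor of the claim is at least 1.\<close>
  have "tv_norm (\<lambda>A. measure (law_at P B t \<nu>') A - inverse (measure \<nu> UNIV) * measure \<nu> A)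
      \<le> 1 * exp (- t / (2 * diameter (UNIV :: 'a set) * measure \<nu> UNIV))"
    unfolding tv_norm_def using law_at_decay[OF assms(5-7,9)] by (intro cSUP_least) auto
  also have "\<dots> \<le> (1 + measure \<nu> UNIV * sqrt (\<integral>x. enn2real (RN_deriv \<nu> \<nu>' x) \<partial>\<nu>'))
      * exp (- t / (2 * diameter (UNIV :: 'a set) * measure \<nu> UNIV))"
    by (intro mult_right_mono) (auto intro!: integral_nonneg)
  finally show ?thesis .
qed

end
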